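(* Let $V$ be a simple Euclidean Jordan algebra of rank $r>1$ with off-diagonal Peirce dimension $d$, and assume $r>2$ or $d>1$. Let $c_1,\dots,c_r$ be a Jordan frame and $x_0\in V_{12}$ with $|x_0|^2=2$. For every $m\in\mathbb N$ the function $$\phi_m(x):=(x\,|\,c_1+\sqrt{-1}\,x_0-c_2)^m,\qquad x\in\mathbb S,$$ is a highest weight vector with respect to $\widetilde{\mathfrak t}_{\mathbb C}$ in $\mathcal H^m(\mathbb S)$.
   Context: $V$ has unit $\mathbf e$, trace form $(x|y)=\operatorname{tr}(xy)$ extended $\mathbb C$-bilinearly to $V_{\mathbb C}$, $|x|=(x|x)^{1/2}$, multiplication operators $L(x)$, $P(x,y)=L(x)L(y)+L(y)L(x)-L(xy)$; $V_{ij}$ are the Peirce spaces of the Jordan frame; $\lambda=\frac d2$. $L=\operatorname{Str}(V)_0$ is the identity component of the structure group, $K^L=\{g\in L:g\mathbf e=\mathbf e\}$, with Lie algebra $\mathfrak k^{\mathfrak l}=\mathfrak{aut}(V)$; $\mathfrak k^{\mathfrak l}_{c_1}=\{D\in\mathfrak k^{\mathfrak l}:Dc_1=0\}$; $\Xi=L\cdot c_1$, $\mathbb S=\{x\in\Xi:|x|=1\}=K^L\cdot c_1$. The Bessel operator $\mathcal Bf=\sum_{\alpha,\beta}\frac{\partial^2f}{\partial x_\alpha\partial x_\beta}P(e_\alpha,e_\beta)x+\lambda\sum_\alpha\frac{\partial f}{\partial x_\alpha}e_\alpha$ (orthonormal basis $(e_\alpha)$ of $V$) is tangential to $\Xi$,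 $\mathcal B_{\mathbf e}=(\mathbf e|\mathcal B)$. $\mathcal P^m(\Xi)$ = restrictions to $\Xi$ of complex-valued homogeneous polynomials of degree $m$ on $V$; $\mathcal H^m(\Xi)=\{p\in\mathcal P^m(\Xi):\mathcal B_{\mathbf e}p=0\}$; $\mathcal H^m(\mathbb S)=\{p|_{\mathbb S}:p\in\mathcal H^m(\Xi)\}$, on which $K^L$ acts by $(k\cdot p)(x)=p(k^{-1}x)$; it is an irreducible $K^L$-representation. $X_0=[L(c_1),L(x_0)]$, $\mathfrak t=\mathbb RX_0$, $\gamma(X_0)=\frac14\sqrt{-1}$; $\widetilde{\mathfrak t}_{\mathbb C}\subseteq\mathfrak k^{\mathfrak l}_{\mathbb C}$ is a maximal torus (Cartan subalgebra, complexification of a maximal torus of $\mathfrak k^{\mathfrak l}$) containing $\mathfrak t_{\mathbb C}$, and $\gamma$ is extended to $\widetilde{\mathfrak t}_{\mathbb C}$ by zero on $\widetilde{\mathfrak t}_{\mathbb C}\cap(\mathfrak k^{\mathfrak l}_{c_1})_{\mathbb C}$. The ordering on $\Phi(\mathfrak k^{\mathfrak l}_{\mathbb C},\widetilde{\mathfrak t}_{\mathbb C})$ is chosen such that $\gamma$ is positive, i.e. roots whose restriction to $\mathfrak t_{\mathbb C}$ is a positive multiple of $\gamma$ are positive. *)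

theory Defs
  imports "HOL-Analysis.Analysis"
begin

text \<open>The powers \<open>x ^ n\<close> are those of the syntactic class \<open>power\<close>, i.e. \<open>x ^ Suc n = x * x ^ n\<close>;
  no associativity of the product is assumed.\<close>

class jordan_algebra = real_vector + power +
  assumes jordan_commute: "x * y = y * x"
    and jordan_distrib: "x * (y + z) = x * y + x * z"
    and jordan_scaleR: "x * (t *\<^sub>R y) = t *\<^sub>R (x * y)"
    and jordan_unit: "1 * x = x"
    and jordan_identity: "(x * x) * (x * y) = x * ((x * x) * y)"

class euclidean_jordan_algebra = euclidean_space + jordan_algebra +
  assumes inner_jordan_assoc: "inner (x * y) z = inner y (x * z)"

definition jordan_ideal :: "'a::jordan_algebra set \<Rightarrow> bool" where
  "jordan_ideal I \<longleftrightarrow> subspace I \<and> (\<forall>x\<in>I. \<forall>y. x * y \<in> I)"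

definition simple_jordan_algebra :: "'a::euclidean_jordan_algebra itself \<Rightarrow> bool" where
  "simple_jordan_algebra _ \<longleftrightarrow> (\<forall>I::'a set. jordan_ideal I \<longrightarrow> I = {0} \<or> I = UNIV)"

text \<open>Degree of the minimal polynomial of an element; the rank is the maximal such degree, and the
  elements attaining it are the regular ones.\<close>

definition min_poly_degree :: "'a::jordan_algebra \<Rightarrow> nat" where
  "min_poly_degree x = (LEAST k. x ^ k \<in> span {x ^ i |i. i < k})"

definition jordan_rank :: "'a::euclidean_jordan_algebra itself \<Rightarrow> nat" where
  "jordan_rank _ = Max (range (min_poly_degree :: 'a \<Rightarrow> nat))"

definition regular_element :: "'a::euclidean_jordan_algebra \<Rightarrow> bool" where
  "regular_element x \<longleftrightarrow> min_poly_degree x = jordan_rank TYPE('a)"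

text \<open>The Jordan trace is the linear form \<open>tr\<close> such that the minimal polynomial of every regular \<open>x\<close>
  is \<open>X^r - tr(x) X^(r-1) + ...\<close>, with \<open>r\<close> the rank. Since \<open>1, x, ..., x^(r-1)\<close> are linearly
  independent for regular \<open>x\<close> and the regular elements are dense, it is unique.\<close>

definition is_jordan_trace :: "('a::euclidean_jordan_algebra \<Rightarrow> real) \<Rightarrow> bool" where
  "is_jordan_trace tr \<longleftrightarrow> linear tr \<and>
     (\<forall>x. regular_element x \<longrightarrow>
        x ^ jordan_rank TYPE('a) - tr x *\<^sub>R x ^ (jordan_rank TYPE('a) - 1)
          \<in> span {x ^ i |i. i < jordan_rank TYPE('a) - 1})"

definition idempotent :: "'a::jordan_algebra \<Rightarrow> bool" where
  "idempotent c \<longleftrightarrow> c * c = c"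

definition primitive_idempotent :: "'a::jordan_algebra \<Rightarrow> bool" where
  "primitive_idempotent c \<longleftrightarrow> idempotent c \<and> c \<noteq> 0 \<and>
     \<not> (\<exists>a b. idempotent a \<and> idempotent b \<and> a \<noteq> 0 \<and> b \<noteq> 0 \<and> a * b = 0 \<and> c = a + b)"

definition jordan_frame :: "nat \<Rightarrow> (nat \<Rightarrow> 'a::jordan_algebra) \<Rightarrow> bool" where
  "jordan_frame r c \<longleftrightarrow> (\<forall>i\<in>{1..r}. primitive_idempotent (c i)) \<and>
     (\<forall>i\<in>{1..r}. \<forall>j\<in>{1..r}. i \<noteq> j \<longrightarrow> c i * c j = 0) \<and> (\<Sum>i=1..r. c i) = 1"

definition peirce_space :: "(nat \<Rightarrow> 'a::jordan_algebra) \<Rightarrow> nat \<Rightarrow> nat \<Rightarrow> 'a set" where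
  "peirce_space c i j =
     (if i = j then {x. c i * x = x}
      else {x. c i * x = (1/2) *\<^sub>R x \<and> c j * x = (1/2) *\<^sub>R x})"

definition mult_op :: "'a::euclidean_jordan_algebra \<Rightarrow> 'a \<Rightarrow>\<^sub>L 'a" where
  "mult_op x = Blinfun (\<lambda>y. x * y)"

definition quad_rep2 :: "'a::jordan_algebra \<Rightarrow> 'a \<Rightarrow> 'a \<Rightarrow> 'a" where
  "quad_rep2 x y = (\<lambda>z. x * (y * z) + y * (x * z) - (x * y) * z)"

definition quad_rep :: "'a::jordan_algebra \<Rightarrow> 'a \<Rightarrow> 'a" where
  "quad_rep x = quad_rep2 x x"

text \<open>A pair \<open>(a, b)\<close> stands for \<open>a + ib\<close>. This is used for \<open>V\<close> as well as for Lie algebras of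
  operators on \<open>V\<close>; sums are the componentwise ones of the product type.\<close>

definition complexify :: "'v set \<Rightarrow> ('v \<times> 'v) set" where
  "complexify W = W \<times> W"

definition cvec :: "'v::real_vector \<Rightarrow> 'v \<times> 'v" where
  "cvec v = (v, 0)"

definition cscale :: "complex \<Rightarrow> 'v::real_vector \<times> 'v \<Rightarrow> 'v \<times> 'v" where
  "cscale z u = (Re z *\<^sub>R fst u - Im z *\<^sub>R snd u, Re z *\<^sub>R snd u + Im z *\<^sub>R fst u)"

definition clinear_on :: "('v::real_vector \<times> 'v) set \<Rightarrow> ('v \<times> 'v \<Rightarrow> complex) \<Rightarrow> bool" where
  "clinear_on W f \<longleftrightarrow> (\<forall>u\<in>W. \<forall>v\<in>W. f (u + v) = f u + f v) \<and>
     (\<forall>z. \<forall>u\<in>W. f (cscale z u) = z * f u)"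

text \<open>The complex bilinear (not sesquilinear) extension of the inner product.\<close>

definition cbilinear :: "'v::real_inner \<times> 'v \<Rightarrow> 'v \<times> 'v \<Rightarrow> complex" where
  "cbilinear u v = Complex (fst u \<bullet> fst v - snd u \<bullet> snd v) (fst u \<bullet> snd v + snd u \<bullet> fst v)"

definition bracket :: "('a::real_normed_vector \<Rightarrow>\<^sub>L 'a) \<Rightarrow> ('a \<Rightarrow>\<^sub>L 'a) \<Rightarrow> ('a \<Rightarrow>\<^sub>L 'a)" where
  "bracket X Y = (X o\<^sub>L Y) - (Y o\<^sub>L X)"

definition cbracket ::
  "('a::real_normed_vector \<Rightarrow>\<^sub>L 'a) \<times> ('a \<Rightarrow>\<^sub>L 'a) \<Rightarrow> ('a \<Rightarrow>\<^sub>L 'a) \<times> ('a \<Rightarrow>\<^sub>L 'a)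
     \<Rightarrow> ('a \<Rightarrow>\<^sub>L 'a) \<times> ('a \<Rightarrow>\<^sub>L 'a)" where
  "cbracket Z W = (bracket (fst Z) (fst W) - bracket (snd Z) (snd W),
                   bracket (fst Z) (snd W) + bracket (snd Z) (fst W))"

text \<open>Adjoints are taken with respect to the inner product of the type, which the theorem requires
  to be the trace form.\<close>

definition structure_group :: "('a::euclidean_jordan_algebra \<Rightarrow>\<^sub>L 'a) set" where
  "structure_group = {g. bij (blinfun_apply g) \<and>
     (\<forall>x. quad_rep (blinfun_apply g x)
            = blinfun_apply g \<circ> quad_rep x \<circ> adjoint (blinfun_apply g))}"

definition structure_group0 :: "('a::euclidean_jordan_algebra \<Rightarrow>\<^sub>L 'a) set" where
  "structure_group0 = connected_component_set structure_group id_blinfun"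

definition Xi_orbit :: "'a::euclidean_jordan_algebra \<Rightarrow> 'a set" where
  "Xi_orbit c1 = (\<lambda>g. blinfun_apply g c1) ` structure_group0"

definition Xi_sphere :: "'a::euclidean_jordan_algebra \<Rightarrow> 'a set" where
  "Xi_sphere c1 = {x \<in> Xi_orbit c1. norm x = 1}"

definition derivations :: "('a::euclidean_jordan_algebra \<Rightarrow>\<^sub>L 'a) set" where
  "derivations = {D. \<forall>x y. blinfun_apply D (x * y) = blinfun_apply D x * y + x * blinfun_apply D y}"

definition stabilizer_derivations ::
  "'a::euclidean_jordan_algebra \<Rightarrow> ('a \<Rightarrow>\<^sub>L 'a) set" where
  "stabilizer_derivations c1 = {D \<in> derivations. blinfun_apply D c1 = 0}"

text \<open>Maximal tori of the Lie algebra of a compact group are its maximal abelian subspaces.\<close>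

definition abelian_in_derivations :: "('a::euclidean_jordan_algebra \<Rightarrow>\<^sub>L 'a) set \<Rightarrow> bool" where
  "abelian_in_derivations T \<longleftrightarrow>
     subspace T \<and> T \<subseteq> derivations \<and> (\<forall>X\<in>T. \<forall>Y\<in>T. bracket X Y = 0)"

definition maximal_torus :: "('a::euclidean_jordan_algebra \<Rightarrow>\<^sub>L 'a) set \<Rightarrow> bool" where
  "maximal_torus T \<longleftrightarrow> abelian_in_derivations T \<and>
     (\<forall>T'. abelian_in_derivations T' \<and> T \<subseteq> T' \<longrightarrow> T' = T)"

text \<open>Functionals on the complexified torus are total functions which vanish off the torus, so that
  distinct functionals are distinct functions.\<close>

definition root_space ::
  "('a::euclidean_jordan_algebra \<Rightarrow>\<^sub>L 'a) set \<Rightarrow> (('a \<Rightarrow>\<^sub>L 'a) \<times> ('a \<Rightarrow>\<^sub>L 'a) \<Rightarrow> complex)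
     \<Rightarrow> (('a \<Rightarrow>\<^sub>L 'a) \<times> ('a \<Rightarrow>\<^sub>L 'a)) set" where
  "root_space T \<alpha> = {Z \<in> complexify derivations.
     \<forall>H\<in>complexify T. cbracket H Z = cscale (\<alpha> H) Z}"

definition roots ::
  "('a::euclidean_jordan_algebra \<Rightarrow>\<^sub>L 'a) set
     \<Rightarrow> (('a \<Rightarrow>\<^sub>L 'a) \<times> ('a \<Rightarrow>\<^sub>L 'a) \<Rightarrow> complex) set" where
  "roots T = {\<alpha>. clinear_on (complexify T) \<alpha> \<and> (\<forall>H. H \<notin> complexify T \<longrightarrow> \<alpha> H = 0) \<and>
     (\<exists>H\<in>complexify T. \<alpha> H \<noteq> 0) \<and> (\<exists>Z\<in>root_space T \<alpha>. Z \<noteq> 0)}"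

text \<open>An ordering of the roots is given by its set of positive roots: it contains exactly one of
  \<open>\<alpha>\<close>, \<open>-\<alpha>\<close> for every root \<open>\<alpha>\<close>, and every root that is a sum of two of its members.\<close>

definition positive_system :: "('h \<Rightarrow> complex) set \<Rightarrow> ('h \<Rightarrow> complex) set \<Rightarrow> bool" where
  "positive_system \<Phi> P \<longleftrightarrow> P \<subseteq> \<Phi> \<and>
     (\<forall>\<alpha>\<in>\<Phi>. \<alpha> \<in> P \<longleftrightarrow> (\<lambda>H. - \<alpha> H) \<notin> P) \<and>
     (\<forall>\<alpha>\<in>P. \<forall>\<beta>\<in>P. (\<lambda>H. \<alpha> H + \<beta> H) \<in> \<Phi> \<longrightarrow> (\<lambda>H. \<alpha> H + \<beta> H) \<in> P)"

definition partial :: "'a::euclidean_space \<Rightarrow> ('a \<Rightarrow> complex) \<Rightarrow> 'a \<Rightarrow> complex" where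
  "partial v f x = frechet_derivative f (at x) v"

definition bessel ::
  "real \<Rightarrow> ('a::euclidean_jordan_algebra \<Rightarrow> complex) \<Rightarrow> 'a \<Rightarrow> 'a \<times> 'a" where
  "bessel lam f x =
     (\<Sum>a\<in>Basis. \<Sum>b\<in>Basis. cscale (partial a (partial b f) x) (cvec (quad_rep2 a b x)))
     + cscale (of_real lam) (\<Sum>a\<in>Basis. cscale (partial a f x) (cvec a))"

definition bessel_unit ::
  "real \<Rightarrow> ('a::euclidean_jordan_algebra \<Rightarrow> complex) \<Rightarrow> 'a \<Rightarrow> complex" where
  "bessel_unit lam f x = cbilinear (cvec 1) (bessel lam f x)"

definition homogeneous_polynomial :: "nat \<Rightarrow> ('a::euclidean_space \<Rightarrow> complex) \<Rightarrow> bool" where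
  "homogeneous_polynomial m p \<longleftrightarrow>
     polynomial_function p \<and> (\<forall>t x. p (t *\<^sub>R x) = of_real (t ^ m) * p x)"

text \<open>Functions on \<open>\<Xi>\<close> and on the sphere are extensional functions. The Bessel operator with
  \<open>lam = d/2\<close> is tangential to \<open>\<Xi>\<close>, so \<open>bessel_unit lam p\<close> on \<open>\<Xi>\<close> depends only on the
  restriction of the polynomial \<open>p\<close> to \<open>\<Xi>\<close>.\<close>

definition harmonics_Xi ::
  "real \<Rightarrow> 'a::euclidean_jordan_algebra \<Rightarrow> nat \<Rightarrow> ('a \<Rightarrow> complex) set" where
  "harmonics_Xi lam c1 m = {restrict p (Xi_orbit c1) |p.
     homogeneous_polynomial m p \<and> (\<forall>x\<in>Xi_orbit c1. bessel_unit lam p x = 0)}"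

definition harmonics_sphere ::
  "real \<Rightarrow> 'a::euclidean_jordan_algebra \<Rightarrow> nat \<Rightarrow> ('a \<Rightarrow> complex) set" where
  "harmonics_sphere lam c1 m = (\<lambda>p. restrict p (Xi_sphere c1)) ` harmonics_Xi lam c1 m"

text \<open>\<open>lie_action\<close> differentiates the translation action \<open>(k \<cdot> p)(x) = p(k\<^sup>-\<^sup>1 x)\<close> along
  \<open>exp(tD)\<close>; for a derivation \<open>D\<close> these operators are automorphisms and preserve the sphere.\<close>

definition op_exp :: "('a::euclidean_space \<Rightarrow>\<^sub>L 'a) \<Rightarrow> ('a \<Rightarrow>\<^sub>L 'a)" where
  "op_exp D = (\<Sum>n. (1 / fact n) *\<^sub>R (((o\<^sub>L) D) ^^ n) id_blinfun)"

definition translate ::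
  "'a::euclidean_space set \<Rightarrow> ('a \<Rightarrow>\<^sub>L 'a) \<Rightarrow> ('a \<Rightarrow> complex) \<Rightarrow> 'a \<Rightarrow> complex" where
  "translate S k p = restrict (\<lambda>x. p (inv (blinfun_apply k) x)) S"

definition lie_action ::
  "'a::euclidean_space set \<Rightarrow> ('a \<Rightarrow>\<^sub>L 'a) \<Rightarrow> ('a \<Rightarrow> complex) \<Rightarrow> 'a \<Rightarrow> complex" where
  "lie_action S D p =
     restrict (\<lambda>x. vector_derivative (\<lambda>t. translate S (op_exp (t *\<^sub>R D)) p x) (at 0)) S"

definition lie_action_complex ::
  "'a::euclidean_space set \<Rightarrow> ('a \<Rightarrow>\<^sub>L 'a) \<times> ('a \<Rightarrow>\<^sub>L 'a) \<Rightarrow> ('a \<Rightarrow> complex) \<Rightarrow> 'a \<Rightarrow> complex" where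
  "lie_action_complex S Z p =
     restrict (\<lambda>x. lie_action S (fst Z) p x + \<i> * lie_action S (snd Z) p x) S"

text \<open>\<open>W\<close> is a representation space of functions on \<open>S\<close>, \<open>T\<close> a maximal torus, \<open>P\<close> the set of
  positive roots.\<close>

definition highest_weight_vector ::
  "'a::euclidean_jordan_algebra set \<Rightarrow> ('a \<Rightarrow> complex) set \<Rightarrow> ('a \<Rightarrow>\<^sub>L 'a) set
     \<Rightarrow> (('a \<Rightarrow>\<^sub>L 'a) \<times> ('a \<Rightarrow>\<^sub>L 'a) \<Rightarrow> complex) set \<Rightarrow> ('a \<Rightarrow> complex) \<Rightarrow> bool" where
  "highest_weight_vector S W T P v \<longleftrightarrow>
     v \<in> W \<and> (\<exists>x\<in>S. v x \<noteq> 0) \<and>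
     (\<exists>\<mu>. clinear_on (complexify T) \<mu> \<and>
        (\<forall>H\<in>complexify T. \<forall>x\<in>S. lie_action_complex S H v x = \<mu> H * v x)) \<and>
     (\<forall>\<alpha>\<in>P. \<forall>Z\<in>root_space T \<alpha>. \<forall>x\<in>S. lie_action_complex S Z v x = 0)"

definition phi ::
  "'a::euclidean_jordan_algebra \<Rightarrow> 'a \<Rightarrow> 'a \<Rightarrow> nat \<Rightarrow> 'a \<Rightarrow> complex" where
  "phi c1 c2 x0 m = restrict
     (\<lambda>x. cbilinear (cvec x) (cvec c1 + cscale \<i> (cvec x0) - cvec c2) ^ m) (Xi_sphere c1)"

end

theory Submission
  imports Defs "HOL-Computational_Algebra.Polynomial"
begin

text \<open>
  Put \<open>w = c\<^sub>1 + i x\<^sub>0 - c\<^sub>2\<close>. Since \<open>x\<^sub>0\<^sup>2 = c\<^sub>1 + c\<^sub>2\<close>, we have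
  \<open>w\<^sup>2 = 0\<close> and \<open>(w|e) = 0\<close>, and \<open>B\<^sub>e\<close> sends \<open>(x|w)\<^sup>m\<close> to
  \<open>m (m - 1) (x|w\<^sup>2) (x|w)\<^bsup>m-2\<^esup> + \<lambda> m (w|e) (x|w)\<^bsup>m-1\<^esup> = 0\<close>.
  Derivations are skew, so \<open>D\<close> acts on \<open>(x|w)\<^sup>m\<close> as \<open>m (x|Dw) (x|w)\<^bsup>m-1\<^esup>\<close>, and
  everything reduces to the action on \<open>w\<close>. On the complexification, \<open>X\<^sub>0\<close> has eigenvalues
  \<open>0\<close>, \<open>\<plusminus>i/4\<close>, \<open>\<plusminus>i/2\<close>, and the eigenspace of \<open>i/2\<close> is spanned by \<open>w\<close>. Hence the torus,
  which commutes with \<open>X\<^sub>0\<close>, scales \<open>w\<close>. For a positive root \<open>\<alpha>\<close>, \<open>\<alpha>(X\<^sub>0)\<close> is a nonnegative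
  multiple of \<open>i\<close>, and a root vector \<open>Z\<close> moves \<open>w\<close> into the eigenspace of
  \<open>i/2 + \<alpha>(X\<^sub>0)\<close>. If \<open>\<alpha>(X\<^sub>0) \<noteq> 0\<close>, this eigenspace is zero.
  If \<open>\<alpha>(X\<^sub>0) = 0\<close>, then \<open>Zw\<close> is a multiple of \<open>w\<close>, and \<open>[H,Z] w = 0\<close> for all \<open>H\<close> in the torus forces
  \<open>Zw = 0\<close>.
\<close>

section \<open>Identities in Jordan algebras\<close>

lemma jordan_distrib_right: "(y + z) * x = y * x + z * (x::'a::jordan_algebra)"
  using jordan_distrib[of x y z] by (simp add: jordan_commute)

lemma jordan_scaleR_left: "(t *\<^sub>R y) * x = t *\<^sub>R (y * (x::'a::jordan_algebra))"
  using jordan_scaleR[of x t y] by (simp add: jordan_commute)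

lemma jordan_zero [simp]: "x * 0 = (0::'a::jordan_algebra)" "0 * x = (0::'a)"
  using jordan_scaleR[of x 0 0] jordan_scaleR_left[of 0 0 x] by simp_all

lemma jordan_minus: "x * - y = - (x * y :: 'a::jordan_algebra)" "- x * y = - (x * y :: 'a)"
  using jordan_scaleR[of x "-1" y] jordan_scaleR_left[of "-1" x y] by simp_all

lemma jordan_diff:
  "x * (y - z) = x * y - (x * z :: 'a::jordan_algebra)" "(y - z) * x = y * x - (z * x :: 'a)"
  using jordan_distrib[of x y "- z"] jordan_distrib_right[of y "- z" x] by (simp_all add: jordan_minus)

lemmas jordan_simps = jordan_distrib jordan_distrib_right jordan_scaleR jordan_scaleR_left
  jordan_minus jordan_diff

lemma jordan_unit_right: "x * 1 = (x::'a::jordan_algebra)"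
  by (metis jordan_commute jordan_unit)

lemma jordan_sum: "x * sum f A = (\<Sum>i\<in>A. x * (f i :: 'a::jordan_algebra))"
  by (induction A rule: infinite_finite_induct) (simp_all add: jordan_simps)

text \<open>The part of the Jordan identity that is linear in \<open>z\<close> once \<open>x\<close>
  is replaced by \<open>x + z\<close>.\<close>

lemma jordan_linear:
  fixes x y z :: "'a::jordan_algebra"
  shows "(x * x) * (z * y) - z * ((x * x) * y) = 2 *\<^sub>R (x * ((x * z) * y) - (x * z) * (x * y))"
proof -
  have zx: "z * x = x * z" by (rule jordan_commute)
  define F where "F = (\<lambda>v. (v * v) * (v * y) - v * ((v * v) * y))"
  have F: "F v = 0" for v unfolding F_def using jordan_identity[of v y] by simp
  \<comment> \<open>\<open>F\<close> is cubic. The difference \<open>F (x + z) - F (x - z)\<close>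
    keeps the terms odd in \<open>z\<close>; subtracting twice \<open>F z\<close> leaves twice the
    linear one.\<close>
  have "2 *\<^sub>R (((x * x) * (z * y) - z * ((x * x) * y)) - 2 *\<^sub>R (x * ((x * z) * y) - (x * z) * (x * y)))
      = F (x + z) - F (x - z) - 2 *\<^sub>R F z"
    unfolding F_def by (simp add: jordan_simps zx algebra_simps scaleR_2)
  then show ?thesis by (simp add: F)
qed

text \<open>The linearised identity, arranged as a formula for multiplication by
  \<open>(x * x) * y\<close>. It yields both the recursion for powers and the Peirce
  calculus.\<close>

lemma jordan_mult_op_square:
  fixes x y z :: "'a::jordan_algebra"
  shows "((x * x) * y) * z - (x * x) * (y * z) = 2 *\<^sub>R ((x * y) * (x * z) - x * (y * (x * z)))"
proof -
  have "((x * x) * y) * z = z * ((x * x) * y)" "y * z = z * y" "y * (x * z) = (x * z) * y"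
    "(x * y) * (x * z) = (x * z) * (x * y)"
    by (rule jordan_commute)+
  then show ?thesis
    using jordan_linear[of x z y] by (simp add: algebra_simps)
qed

lemma jordan_square_power: "(x * x) * x ^ n = (x ^ Suc (Suc n) :: 'a::jordan_algebra)"
proof (induction n)
  case 0
  then show ?case by (simp add: jordan_unit_right)
next
  case (Suc n)
  then show ?case using jordan_identity[of x "x ^ n"] by simp
qed

lemma jordan_power_step:
  fixes x z :: "'a::jordan_algebra"
  shows "x ^ Suc (Suc n) * z = (x * x) * (x ^ n * z) + 2 *\<^sub>R (x ^ Suc n * (x * z) - x * (x ^ n * (x * z)))"
  using jordan_mult_op_square[of x "x ^ n" z] jordan_square_power[of x n] by (simp add: algebra_simps)

text \<open>By the step formula, every \<open>L(x\<^sup>n)\<close> is a polynomial in the commuting operators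
  \<open>L(x)\<close> and \<open>L(x\<^sup>2)\<close>.\<close>

lemma jordan_power_commute:
  fixes x z :: "'a::jordan_algebra"
  shows "x * (x ^ n * z) = x ^ n * (x * z)"
proof -
  \<comment> \<open>Two consecutive exponents are carried, because \<open>jordan_power_step\<close>
    refers back to both \<open>n\<close> and \<open>Suc n\<close>.\<close>
  have "\<forall>z. x * (x ^ n * z) = x ^ n * (x * z) \<and> x * (x ^ Suc n * z) = x ^ Suc n * (x * z)"
  proof (induction n)
    case 0
    then show ?case by (simp add: jordan_unit jordan_unit_right)
  next
    case (Suc n)
    have "x * (x ^ Suc (Suc n) * z) = x ^ Suc (Suc n) * (x * z)" for z
    proof -
      have "x * (x ^ Suc (Suc n) * z) = x * ((x * x) * (x ^ n * z)) +
          2 *\<^sub>R (x * (x ^ Suc n * (x * z)) - x * (x * (x ^ n * (x * z))))"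
        unfolding jordan_power_step[of x n z] by (simp only: jordan_simps)
      also have "x * ((x * x) * (x ^ n * z)) = (x * x) * (x * (x ^ n * z))"
        by (rule jordan_identity[symmetric])
      also have "\<dots> = (x * x) * (x ^ n * (x * z))" using Suc by simp
      also have "x * (x ^ Suc n * (x * z)) = x ^ Suc n * (x * (x * z))" using Suc by blast
      also have "x * (x * (x ^ n * (x * z))) = x * (x ^ n * (x * (x * z)))" using Suc by simp
      also have "(x * x) * (x ^ n * (x * z)) +
          2 *\<^sub>R (x ^ Suc n * (x * (x * z)) - x * (x ^ n * (x * (x * z)))) = x ^ Suc (Suc n) * (x * z)"
        by (rule jordan_power_step[symmetric])
      finally show ?thesis .
    qed
    then show ?case using Suc by blast
  qed
  then show ?thesis by blast
qed

text \<open>Power associativity: factors \<open>x\<close> are moved across \<open>x ^ m\<close> one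
  at a time.\<close>

lemma jordan_power_add: "x ^ m * x ^ n = (x ^ (m + n) :: 'a::jordan_algebra)"
proof (induction n)
  case 0
  then show ?case by (simp add: jordan_unit_right)
next
  case (Suc n)
  then show ?case using jordan_power_commute[of x m "x ^ n"] by simp
qed

lemma jordan_bilinear: "bilinear ((*) :: 'a::euclidean_jordan_algebra \<Rightarrow> 'a \<Rightarrow> 'a)"
  unfolding bilinear_def by (intro allI conjI linearI; simp add: jordan_simps)

lemma bounded_bilinear_jordan:
  "bounded_bilinear ((*) :: 'a::euclidean_jordan_algebra \<Rightarrow> 'a \<Rightarrow> 'a)"
  using jordan_bilinear bilinear_conv_bounded_bilinear by blast

lemma jordan_linear_right: "linear ((*) (x :: 'a::euclidean_jordan_algebra))"
  using jordan_bilinear unfolding bilinear_def by blast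

lemma inner_jordan: "inner (x * y) (z::'a::euclidean_jordan_algebra) = inner x (y * z)"
  by (metis inner_jordan_assoc jordan_commute)

section \<open>Spectral decomposition\<close>

text \<open>The algebra of real polynomials in \<open>x\<close>.\<close>

definition power_span :: "'a::jordan_algebra \<Rightarrow> 'a set" where
  "power_span x = span (range ((^) x))"

lemma power_span_mult_self: "y \<in> power_span x \<Longrightarrow> x * y \<in> power_span (x::'a::jordan_algebra)"
  unfolding power_span_def
proof (induction rule: span_induct_alt)
  case base
  then show ?case by (simp add: span_zero)
next
  case (step t y z)
  then obtain n where "y = x ^ n" by auto
  then have "x * y = x ^ Suc n" by simp
  then have "x * y \<in> span (range ((^) x))" by (metis rangeI span_base)
  with step show ?case by (simp add: jordan_simps span_add span_scale)
qed

lemma power_span_mult_assoc: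
  assumes y: "y \<in> power_span x" and z: "z \<in> power_span (x::'a::jordan_algebra)"
  shows "(x * y) * z = x * (y * z)"
  using y unfolding power_span_def
proof (induction rule: span_induct_alt)
  case base
  then show ?case by simp
next
  case (step t y w)
  then obtain n where n: "y = x ^ n" by auto
  have "(x * y) * z = x * (y * z)"
    using z unfolding power_span_def
  proof (induction rule: span_induct_alt)
    case base
    then show ?case by simp
  next
    case (step t v w)
    then obtain k where k: "v = x ^ k" by auto
    have "x ^ Suc n * x ^ k = x * (x ^ n * x ^ k)" by (simp only: jordan_power_add) simp
    with step n k show ?case by (simp add: jordan_simps)
  qed
  with step show ?case by (simp add: jordan_simps)
qed

text \<open>On an eigenvector of \<open>x\<close>, a polynomial in \<open>x\<close> acts by its
  value at the eigenvalue, by associativity inside \<open>power_span x\<close>.\<close>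

lemma power_span_mult_eigenvector:
  assumes v: "v \<in> power_span x" "x * v = l *\<^sub>R v" and y: "y \<in> power_span (x::'a::jordan_algebra)"
  shows "\<exists>t. y * v = t *\<^sub>R v"
  using y unfolding power_span_def
proof (induction rule: span_induct_alt)
  case base
  then show ?case by (metis jordan_zero(2) scaleR_zero_left)
next
  case (step t y w)
  then obtain n where n: "y = x ^ n" by auto
  have "x ^ n * v = l ^ n *\<^sub>R v" for n
  proof (induction n)
    case 0
    then show ?case by (simp add: jordan_unit)
  next
    case (Suc n)
    have "x ^ n \<in> power_span x" unfolding power_span_def by (simp add: span_base)
    then show ?case
      using Suc power_span_mult_assoc[of "x ^ n" x v] v by (simp add: jordan_simps)
  qed
  moreover from step obtain s where "w * v = s *\<^sub>R v" by blast
  ultimately have "(t *\<^sub>R y + w) * v = (t * l ^ n + s) *\<^sub>R v"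
    using n by (simp add: jordan_simps scaleR_add_left)
  then show ?case by blast
qed

text \<open>\<open>v * v\<close> is a multiple of \<open>v\<close>, and the factor is nonzero
  because \<open>v \<bullet> v = (v * v) \<bullet> 1\<close>. Dividing \<open>v\<close> by it gives
  an idempotent.\<close>

lemma eigenvector_idempotent:
  assumes "v \<in> power_span x" "x * v = l *\<^sub>R v" and "v \<noteq> (0::'a::euclidean_jordan_algebra)"
  obtains t u where "v = t *\<^sub>R u" "idempotent u"
proof -
  obtain m where m: "v * v = m *\<^sub>R v" using power_span_mult_eigenvector[OF assms(1,2,1)] by blast
  have "v \<bullet> v = (v * v) \<bullet> 1" by (simp add: inner_jordan jordan_unit_right)
  then have "m \<noteq> 0" using m assms(3) by auto
  then have "idempotent (inverse m *\<^sub>R v)" "v = m *\<^sub>R (inverse m *\<^sub>R v)"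
    using m by (simp_all add: idempotent_def jordan_simps)
  then show ?thesis using that by blast
qed

text \<open>The eigenvector is a maximiser of the Rayleigh quotient on the unit sphere of
  \<open>S\<close>, with the maximum \<open>M\<close> as eigenvalue.\<close>

lemma self_adjoint_eigenvector:
  fixes f :: "'a::euclidean_space \<Rightarrow> 'a"
  assumes S: "subspace S" "S \<noteq> {0}" and f: "linear f" "\<And>v. v \<in> S \<Longrightarrow> f v \<in> S"
    and sym: "\<And>v w. v \<in> S \<Longrightarrow> w \<in> S \<Longrightarrow> f v \<bullet> w = v \<bullet> f w"
  obtains v l where "v \<in> S" "v \<noteq> 0" "f v = l *\<^sub>R v"
proof -
  define K where "K = S \<inter> sphere 0 1"
  have "compact K" unfolding K_def
    using closed_subspace[OF S(1)] by (simp add: compact_Int closed_Int_compact)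
  moreover have "K \<noteq> {}"
  proof -
    obtain v where v: "v \<in> S" "v \<noteq> 0" using S subspace_0 by blast
    then have "inverse (norm v) *\<^sub>R v \<in> K" unfolding K_def using S by (simp add: subspace_scale)
    then show ?thesis by blast
  qed
  moreover have "continuous_on K (\<lambda>v. f v \<bullet> v)"
    using f(1) by (intro continuous_intros linear_continuous_on linear_conv_bounded_linear[THEN iffD1])
  ultimately obtain v where v: "v \<in> K" and max: "\<And>w. w \<in> K \<Longrightarrow> f w \<bullet> w \<le> f v \<bullet> v"
    using continuous_attains_sup[of K "\<lambda>v. f v \<bullet> v"] by blast
  define M where "M = f v \<bullet> v"
  define g where "g = (\<lambda>w. M *\<^sub>R w - f w)"
  have vS: "v \<in> S" and nv: "norm v = 1" using v unfolding K_def by auto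
  have g: "linear g" unfolding g_def using f(1) by (intro linear_compose_sub linear_scaleR) 
  have gS: "g w \<in> S" if "w \<in> S" for w unfolding g_def using that S f by (simp add: subspace_diff subspace_scale)
  have gsym: "g a \<bullet> b = a \<bullet> g b" if "a \<in> S" "b \<in> S" for a b
    unfolding g_def using sym[OF that] by (simp add: inner_diff_left inner_diff_right)
  have pos: "0 \<le> g w \<bullet> w" if w: "w \<in> S" for w
  proof (cases "w = 0")
    case False
    have "inverse (norm w) *\<^sub>R w \<in> K" unfolding K_def using S w False by (simp add: subspace_scale)
    then have "f (inverse (norm w) *\<^sub>R w) \<bullet> (inverse (norm w) *\<^sub>R w) \<le> M" using max M_def by blast
    then have "(f w \<bullet> w) / (norm w)\<^sup>2 \<le> M"
      using f(1) by (simp add: linear_scale field_simps power2_eq_square)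
    then have "f w \<bullet> w \<le> M * (norm w)\<^sup>2" using False by (simp add: field_simps)
    then show ?thesis by (simp add: g_def inner_diff_left power2_norm_eq_inner)
  qed (simp add: g_def)
  have gv: "g v \<bullet> v = 0" using nv by (simp add: g_def M_def inner_diff_left norm_eq_1)
  \<comment> \<open>A nonnegative symmetric form that vanishes at \<open>v\<close> has
    \<open>v\<close> in its radical; otherwise a small move along \<open>w\<close> would make it
    negative.\<close>
  have "g v \<bullet> w = 0" if w: "w \<in> S" for w
  proof (rule ccontr)
    assume ne: "g v \<bullet> w \<noteq> 0"
    define B where "B = g v \<bullet> w"
    define C where "C = g w \<bullet> w"
    \<comment> \<open>The denominator \<open>C + 1\<close> keeps \<open>s\<close> defined when
      \<open>C = 0\<close>.\<close>
    define s where "s = - B / (C + 1)"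
    have C: "C \<ge> 0" using pos[OF w] C_def by simp
    have "v + s *\<^sub>R w \<in> S" using S w vS by (simp add: subspace_add subspace_scale)
    then have "0 \<le> g (v + s *\<^sub>R w) \<bullet> (v + s *\<^sub>R w)" by (rule pos)
    also have "\<dots> = 2 * s * B + s\<^sup>2 * C"
      using gv gsym[OF w vS] linear_add[OF g] linear_scale[OF g]
      by (simp add: inner_add_left inner_add_right B_def C_def inner_commute power2_eq_square algebra_simps)
    also have "\<dots> = - (s\<^sup>2 * (C + 2))"
    proof -
      have B: "B = - s * (C + 1)" using C unfolding s_def by (simp add: field_simps)
      show ?thesis by (subst B, simp add: power2_eq_square algebra_simps)
    qed
    also have "\<dots> < 0" using ne C unfolding s_def B_def by simp
    finally show False by simp
  qed
  from this[OF gS[OF vS]] have "f v = M *\<^sub>R v" by (simp add: g_def)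
  moreover have "v \<noteq> 0" using nv by auto
  ultimately show ?thesis using that vS by blast
qed

lemma subspace_power_span: "subspace (power_span x)"
  unfolding power_span_def by simp

lemma one_in_power_span: "1 \<in> power_span x"
  unfolding power_span_def by (rule span_base) (metis power_0 rangeI)

lemma self_in_power_span: "x \<in> power_span x"
  using power_span_mult_self[OF one_in_power_span, of x] by (simp add: jordan_unit_right)

text \<open>Spectral theorem: \<open>x\<close> acts self-adjointly on the polynomials in
  \<open>x\<close>. The orthogonal complement of its eigenvectors there is invariant, hence zero,
  and each eigenvector is a multiple of an idempotent. Linear claims may thus be checked on
  idempotents.\<close>

lemma span_idempotents: "span (Collect idempotent) = (UNIV :: 'a::euclidean_jordan_algebra set)"
proof -
  have "x \<in> span (Collect idempotent)" for x :: 'a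
  proof -
    define A where "A = power_span x"
    define E where "E = {u \<in> A. \<exists>l. x * u = l *\<^sub>R u}"
    define S where "S = A \<inter> {v. \<forall>u\<in>E. u \<bullet> v = 0}"
    have A: "subspace A" unfolding A_def by (rule subspace_power_span)
    have S: "subspace S" unfolding S_def using A
      by (auto simp: subspace_def inner_add_right)
    have "S = {0}"
    proof (rule ccontr)
      assume ne: "S \<noteq> {0}"
      have xS: "x * v \<in> S" if v: "v \<in> S" for v
      proof -
        have "u \<bullet> (x * v) = 0" if u: "u \<in> E" for u
        proof -
          obtain l where "x * u = l *\<^sub>R u" using u unfolding E_def by blast
          then show ?thesis using u v by (simp add: inner_jordan_assoc[symmetric] S_def)
        qed
        then show ?thesis using v power_span_mult_self unfolding S_def A_def by blast
      qed
      obtain v l where "v \<in> S" "v \<noteq> 0" "x * v = l *\<^sub>R v"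
        using self_adjoint_eigenvector[OF S ne jordan_linear_right xS inner_jordan_assoc] by blast
      then show False unfolding S_def E_def by auto
    qed
    have EA: "span E \<subseteq> A" using A by (intro span_minimal) (auto simp: E_def)
    obtain y z where y: "y \<in> span E" and z: "\<And>w. w \<in> span E \<Longrightarrow> orthogonal z w" and xyz: "x = y + z"
      using orthogonal_subspace_decomp_exists[of E x] by blast
    have "z = x - y" using xyz by simp
    then have "z \<in> A" using A y EA self_in_power_span unfolding A_def by (auto intro: subspace_diff)
    moreover have "\<forall>u\<in>E. u \<bullet> z = 0" using z span_base by (metis inner_commute orthogonal_def)
    ultimately have "z \<in> S" unfolding S_def by blast
    then have "x \<in> span E" using \<open>S = {0}\<close> xyz y by simp
    moreover have "E \<subseteq> span (Collect idempotent)"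
    proof
      fix v assume v: "v \<in> E"
      show "v \<in> span (Collect idempotent)"
      proof (cases "v = 0")
        case True
        then show ?thesis by (simp add: span_zero)
      next
        case False
        obtain l where "x * v = l *\<^sub>R v" using v E_def by auto
        then obtain t u where "v = t *\<^sub>R u" "idempotent u"
          using eigenvector_idempotent[of v x l] v False unfolding E_def A_def by auto
        then show ?thesis by (simp add: span_base span_scale)
      qed
    qed
    ultimately show ?thesis by (metis span_mono span_span subsetD)
  qed
  then show ?thesis by blast
qed

section \<open>Peirce calculus\<close>

text \<open>In \<open>jordan_linear\<close> at \<open>e\<close> the two sides are once and twice the
  same difference, which therefore vanishes.\<close>

lemma peirce_one_commute:
  assumes "idempotent e" "e * x = x"
  shows "e * (x * z) = x * (e * (z::'a::jordan_algebra))"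
  using jordan_linear[of e x z] assms by (simp add: idempotent_def scaleR_2)

lemma peirce_zero_commute:
  assumes "idempotent e" "e * x = 0"
  shows "e * (x * z) = x * (e * (z::'a::jordan_algebra))"
  using jordan_linear[of e x z] assms by (simp add: idempotent_def)

text \<open>Evaluate \<open>e * (x * y)\<close> twice: commuting \<open>e\<close> past
  \<open>x\<close> gives \<open>0\<close>, commuting it past \<open>y\<close> gives
  \<open>x * y\<close>.\<close>

lemma peirce_one_zero:
  assumes e: "idempotent e" and x: "e * x = x" and y: "e * y = (0::'a::jordan_algebra)"
  shows "x * y = 0"
  using peirce_one_commute[OF e x, of y] peirce_zero_commute[OF e y, of x] x y
  by (simp add: jordan_commute[of x y])

text \<open>In \<open>jordan_linear\<close> at \<open>x\<close>, with \<open>e\<close> for both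
  other arguments, the right side cancels. So the square of a half vector has no half
  component.\<close>

lemma peirce_half_square:
  assumes e: "idempotent e" and x: "e * x = (1/2) *\<^sub>R (x::'a::jordan_algebra)"
  shows "e * (e * (x * x)) = e * (x * x)"
proof -
  have "x * e = (1/2) *\<^sub>R x" using x by (simp add: jordan_commute)
  then have "(x * x) * (e * e) = e * ((x * x) * e)"
    using jordan_linear[of x e e] by (simp add: jordan_simps)
  then show ?thesis using e by (simp add: idempotent_def jordan_commute)
qed

text \<open>Doubled multiplication represents the 1-space of \<open>e\<close> as a Jordan algebra on
  the half space. This is the case of squares, from \<open>jordan_mult_op_square\<close> with middle
  argument \<open>e\<close>; \<open>peirce_one_half_mult\<close> is its polarisation.\<close>

lemma peirce_one_half_square:
  assumes e: "idempotent e" and a: "e * a = a" and w: "e * w = (1/2) *\<^sub>R (w::'a::jordan_algebra)"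
  shows "(a * a) * w = 2 *\<^sub>R (a * (a * w))"
proof -
  have aa: "e * (a * a) = a * a" using peirce_one_commute[OF e a, of a] a by simp
  have aw: "e * (a * w) = (1/2) *\<^sub>R (a * w)" using peirce_one_commute[OF e a, of w] w
    by (simp add: jordan_simps)
  have "((a * a) * e) * w - (a * a) * (e * w) = 2 *\<^sub>R ((a * e) * (a * w) - a * (e * (a * w)))"
    by (rule jordan_mult_op_square)
  then have "(a * a) * w - (1/2) *\<^sub>R ((a * a) * w) = 2 *\<^sub>R (a * (a * w) - (1/2) *\<^sub>R (a * (a * w)))"
    using aa a w aw by (simp add: jordan_commute jordan_simps)
  moreover have "v - (1/2) *\<^sub>R v = (1/2) *\<^sub>R v" for v :: 'a
    using scaleR_diff_left[of 1 "1/2" v] by simp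
  ultimately have "(1/2) *\<^sub>R ((a * a) * w) = a * (a * w)" by simp
  then show ?thesis by (metis scaleR_half_double scaleR_2 scaleR_add_right)
qed

lemma peirce_one_half_mult:
  assumes e: "idempotent e" and a: "e * a = a" and b: "e * b = b"
    and w: "e * w = (1/2) *\<^sub>R (w::'a::jordan_algebra)"
  shows "(a * b) * w = a * (b * w) + b * (a * w)"
proof -
  have "e * (a + b) = a + b" using a b by (simp add: jordan_simps)
  from peirce_one_half_square[OF e this w] peirce_one_half_square[OF e a w] peirce_one_half_square[OF e b w]
  have "2 *\<^sub>R ((a * b) * w) = 2 *\<^sub>R (a * (b * w) + b * (a * w))"
    by (simp add: jordan_simps scaleR_2 jordan_commute[of b a] algebra_simps)
  then show ?thesis by simp
qed

lemma peirce_decomposition: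
  assumes e: "idempotent (e::'a::jordan_algebra)"
  obtains u v w where "z = u + v + w" "e * u = u" "e * v = (1/2) *\<^sub>R v" "e * w = 0"
proof -
  define a where "a = e * z"
  define b where "b = e * a"
  \<comment> \<open>Multiplication L by \<open>e\<close> satisfies 2L^3 - 3L^2 + L = 0, so its
    possible eigenvalues are 0, 1/2 and 1.\<close>
  have "a - b = 2 *\<^sub>R (b - e * b)"
    using jordan_mult_op_square[of e e z] e unfolding a_def b_def by (simp add: idempotent_def)
  then have "2 *\<^sub>R (e * b) = 2 *\<^sub>R b + b - a"
    by (simp add: algebra_simps)
  then have eb: "e * b = (1/2) *\<^sub>R (2 *\<^sub>R b + b - a)"
    by (metis scaleR_half_double scaleR_2 scaleR_add_right)
  have n: "3 *\<^sub>R v = v + v + v" "4 *\<^sub>R v = v + v + v + v" for v :: 'a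
    using scaleR_add_left[of 2 1 v] scaleR_add_left[of 2 2 v] by (simp_all add: scaleR_2 algebra_simps)
  have half: "(1/2) *\<^sub>R (v + v) = v" for v :: 'a
    by (metis scaleR_2 scaleR_half_double scaleR_add_right)
  \<comment> \<open>The three components are the Lagrange interpolation polynomials 2L^2 - L, 4L -
    4L^2 and 1 - 3L + 2L^2 applied to \<open>z\<close>.\<close>
  show ?thesis
  proof (rule that[of "2 *\<^sub>R b - a" "4 *\<^sub>R a - 4 *\<^sub>R b" "z - 3 *\<^sub>R a + 2 *\<^sub>R b"])
    show "z = 2 *\<^sub>R b - a + (4 *\<^sub>R a - 4 *\<^sub>R b) + (z - 3 *\<^sub>R a + 2 *\<^sub>R b)"
      by (simp add: n scaleR_2)
    have eb2: "e * b + e * b = b + b + b - a"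
      using half[of "2 *\<^sub>R b + b - a"] by (subst (1 2) eb) (simp add: scaleR_2 flip: scaleR_add_right)
    show "e * (2 *\<^sub>R b - a) = 2 *\<^sub>R b - a"
      using eb2 by (simp add: jordan_simps b_def[symmetric] scaleR_2 algebra_simps)
    show "e * (4 *\<^sub>R a - 4 *\<^sub>R b) = (1/2) *\<^sub>R (4 *\<^sub>R a - 4 *\<^sub>R b)"
    proof -
      have "e * (4 *\<^sub>R a - 4 *\<^sub>R b) = (b + b - (e * b + e * b)) + (b + b - (e * b + e * b))"
        by (simp add: jordan_simps b_def[symmetric] n)
      also have "\<dots> = (a - b) + (a - b)" unfolding eb2 by (simp add: algebra_simps)
      also have "\<dots> = (1/2) *\<^sub>R ((a - b) + (a - b) + ((a - b) + (a - b)))" by (rule half[symmetric])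
      also have "(a - b) + (a - b) + ((a - b) + (a - b)) = 4 *\<^sub>R a - 4 *\<^sub>R b" by (simp add: n)
      finally show ?thesis .
    qed
    show "e * (z - 3 *\<^sub>R a + 2 *\<^sub>R b) = 0"
      using eb2 by (simp add: jordan_simps b_def[symmetric] a_def[symmetric] n scaleR_2 algebra_simps)
  qed
qed

text \<open>An eigenvector of \<open>x\<close> yields an idempotent \<open>u\<close> with
  \<open>c * u = u\<close>. Primitivity forces \<open>u = c\<close>, and then
  \<open>x = x * c\<close> is the eigenvalue times \<open>c\<close>.\<close>

lemma primitive_peirce_one:
  assumes c: "primitive_idempotent c" and x: "c * x = (x::'a::euclidean_jordan_algebra)"
  obtains t where "x = t *\<^sub>R c"
proof (cases "x = 0")
  case True
  then show ?thesis using that[of 0] by simp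
next
  case False
  have cc: "idempotent c" using c by (simp add: primitive_idempotent_def)
  \<comment> \<open>Polynomials in \<open>x\<close> without constant term: on these \<open>c\<close>
    acts as the identity.\<close>
  define S where "S = (*) x ` power_span x"
  have S: "subspace S" unfolding S_def
    using linear_subspace_image[OF jordan_linear_right subspace_power_span] .
  have "x * 1 \<in> S" unfolding S_def using one_in_power_span by blast
  then have ne: "S \<noteq> {0}" using False by (auto simp: jordan_unit_right)
  have SA: "S \<subseteq> power_span x" unfolding S_def using power_span_mult_self by blast
  have xS: "x * v \<in> S" if "v \<in> S" for v using that SA unfolding S_def by blast
  obtain v l where v: "v \<in> S" "v \<noteq> 0" "x * v = l *\<^sub>R v"
    using self_adjoint_eigenvector[OF S ne jordan_linear_right xS inner_jordan_assoc] by blast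
  obtain y where y: "v = x * y" using v(1) S_def by blast
  have "l \<noteq> 0"
  proof
    assume "l = 0"
    then have "v \<bullet> v = 0" using v(3) by (subst (1) y) (simp add: inner_jordan_assoc[of x y])
    then show False using v(2) by simp
  qed
  have cv: "c * v = v"
  proof -
    have "c * (x * z) = x * z" if "z \<in> power_span x" for z
      using that unfolding power_span_def
    proof (induction rule: span_induct_alt)
      case base
      then show ?case by simp
    next
      case (step t w z)
      then obtain n where n: "w = x ^ n" by auto
      have "c * (x * x ^ n) = x * x ^ n"
      proof (induction n)
        case 0
        then show ?case using x by (simp add: jordan_unit_right)
      next
        case (Suc n)
        then show ?case using peirce_one_commute[OF cc x, of "x ^ Suc n"] by simp
      qed
      with step n show ?case by (simp add: jordan_simps)
    qed
    then show ?thesis using v(1) unfolding S_def by blast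
  qed
  obtain t u where u: "v = t *\<^sub>R u" "idempotent u"
    using eigenvector_idempotent[of v x l] v SA by blast
  have t: "t \<noteq> 0" "u \<noteq> 0" using u v(2) by auto
  have cu: "c * u = u" using cv u t by (simp add: jordan_simps)
  have uu: "u * u = u" "c * c = c" using u cc by (simp_all add: idempotent_def)
  have "c - u = 0"
  proof (rule ccontr)
    assume "c - u \<noteq> 0"
    moreover have "idempotent (c - u)" "u * (c - u) = 0"
      using cu uu by (simp_all add: idempotent_def jordan_simps jordan_commute[of u c])
    ultimately show False using c u(2) t(2) unfolding primitive_idempotent_def
      by (metis add.commute diff_add_cancel)
  qed
  moreover have "x * u = l *\<^sub>R u"
  proof -
    have "t *\<^sub>R (x * u) = t *\<^sub>R (l *\<^sub>R u)" using v(3) u by (simp add: jordan_simps)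
    then show ?thesis using t by (metis scaleR_left_imp_eq)
  qed
  ultimately show ?thesis using that[of l] x by (simp add: jordan_commute)
qed

section \<open>Derivations\<close>

text \<open>It suffices to treat an idempotent \<open>u\<close>. Its derivative is
  \<open>a = 2 (u * a)\<close>; pairing with \<open>u\<close> gives
  \<open>a \<bullet> u = 0\<close>, and pairing with \<open>1\<close> then gives the claim.\<close>

lemma derivation_trace_zero:
  assumes D: "D \<in> (derivations :: ('a::euclidean_jordan_algebra \<Rightarrow>\<^sub>L 'a) set)"
  shows "blinfun_apply D x \<bullet> 1 = 0"
proof -
  have d: "blinfun_apply D (x * y) = blinfun_apply D x * y + x * blinfun_apply D y" for x y
    using D by (simp add: derivations_def)
  have "blinfun_apply D u \<bullet> 1 = 0" if u: "u * u = u" for u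
  proof -
    define a where "a = blinfun_apply D u"
    have a: "a = 2 *\<^sub>R (u * a)" using d[of u u] u by (simp add: a_def scaleR_2 jordan_commute)
    have "a \<bullet> u = 2 * (a \<bullet> (u * u))"
      by (subst a) (simp add: inner_jordan_assoc)
    then have "a \<bullet> u = 0" using u by simp
    moreover have "a \<bullet> 1 = 2 * (a \<bullet> u)"
      by (subst a) (simp add: inner_jordan_assoc jordan_unit_right)
    ultimately show ?thesis by (simp add: a_def)
  qed
  then have "Collect idempotent \<subseteq> {x. blinfun_apply D x \<bullet> 1 = 0}" by (auto simp: idempotent_def)
  moreover have "subspace {x. blinfun_apply D x \<bullet> 1 = 0}"
    by (auto simp: subspace_def blinfun.bilinear_simps inner_add_left)
  ultimately have "span (Collect idempotent) \<subseteq> {x. blinfun_apply D x \<bullet> 1 = 0}"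
    by (rule span_minimal)
  then show ?thesis by (auto simp: span_idempotents)
qed

text \<open>Pair the product rule for \<open>x * y\<close> with the unit.\<close>

lemma derivation_skew:
  assumes D: "D \<in> (derivations :: ('a::euclidean_jordan_algebra \<Rightarrow>\<^sub>L 'a) set)"
  shows "blinfun_apply D x \<bullet> y = - (x \<bullet> blinfun_apply D y)"
proof -
  have "0 = blinfun_apply D (x * y) \<bullet> 1" using derivation_trace_zero[OF D] by simp
  also have "\<dots> = (blinfun_apply D x * y) \<bullet> 1 + (x * blinfun_apply D y) \<bullet> 1"
    using D by (simp add: derivations_def inner_add_left)
  also have "\<dots> = blinfun_apply D x \<bullet> y + x \<bullet> blinfun_apply D y"
    by (simp add: inner_jordan jordan_unit_right)
  finally show ?thesis by simp
qed

section \<open>The trace of a primitive idempotent\<close>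

text \<open>The product is monic and its subleading coefficient is given by Vieta's formula;
  \<open>Suc n = card A\<close> leaves out the empty set.\<close>

lemma coeff_prod_linear:
  fixes a :: "'b \<Rightarrow> real"
  assumes "finite A"
  shows "coeff (\<Prod>i\<in>A. [:- a i, 1:]) (card A) = 1 \<and>
    (\<forall>j>card A. coeff (\<Prod>i\<in>A. [:- a i, 1:]) j = 0) \<and>
    (\<forall>n. Suc n = card A \<longrightarrow> coeff (\<Prod>i\<in>A. [:- a i, 1:]) n = - sum a A)"
  using assms
proof (induction A rule: finite_induct)
  case empty
  then show ?case by (auto simp: coeff_pCons split: nat.split)
next
  case (insert x F)
  define p where "p = (\<Prod>i\<in>F. [:- a i, 1:])"
  have "coeff (smult (- a x) p + pCons 0 p) (Suc (card F)) = 1"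
    and "\<forall>j>Suc (card F). coeff (smult (- a x) p + pCons 0 p) j = 0"
    using insert.IH unfolding p_def[symmetric] by (auto simp: coeff_pCons split: nat.split)
  moreover have "coeff (smult (- a x) p + pCons 0 p) (card F) = - (a x + sum a F)"
  proof (cases "card F")
    case 0
    then have "F = {}" using insert by simp
    then show ?thesis using 0 by (simp add: p_def)
  next
    case (Suc n)
    then show ?thesis using insert.IH unfolding p_def[symmetric] by (auto simp: coeff_pCons)
  qed
  ultimately show ?case using insert by (simp add: p_def)
qed

lemma jordan_frameD:
  assumes "jordan_frame r c" "i \<in> {1..r}"
  shows "primitive_idempotent (c i)" "c i * c i = c i" "c i \<noteq> 0"
    "\<And>j. j \<in> {1..r} \<Longrightarrow> j \<noteq> i \<Longrightarrow> c i * c j = 0"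
  using assms by (auto simp: jordan_frame_def primitive_idempotent_def idempotent_def)

lemma frame_mult_sum:
  assumes "jordan_frame r c" "i \<in> {1..r}"
  shows "c i * (\<Sum>j=1..r. b j *\<^sub>R c j) = b i *\<^sub>R (c i :: 'a::jordan_algebra)"
proof -
  have "c i * (\<Sum>j=1..r. b j *\<^sub>R c j) = (\<Sum>j=1..r. if j = i then b i *\<^sub>R c i else 0)"
    unfolding jordan_sum using jordan_frameD[OF assms] by (intro sum.cong) (auto simp: jordan_simps)
  then show ?thesis using assms by simp
qed

lemma frame_sum_eq_0_iff:
  assumes "jordan_frame r c"
  shows "(\<Sum>j=1..r. b j *\<^sub>R c j) = (0 :: 'a::jordan_algebra) \<longleftrightarrow> (\<forall>i\<in>{1..r}. b i = 0)"
proof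
  assume 0: "(\<Sum>j=1..r. b j *\<^sub>R c j) = 0"
  show "\<forall>i\<in>{1..r}. b i = 0"
  proof
    fix i assume i: "i \<in> {1..r}"
    show "b i = 0" using frame_mult_sum[OF assms i, of b] jordan_frameD[OF assms i] 0 by simp
  qed
qed simp

lemma frame_power:
  assumes "jordan_frame r c"
  shows "(\<Sum>i=1..r. a i *\<^sub>R c i) ^ k = (\<Sum>i=1..r. a i ^ k *\<^sub>R (c i :: 'a::jordan_algebra))"
proof (induction k)
  case 0
  then show ?case using assms by (simp add: jordan_frame_def)
next
  case (Suc k)
  have "(\<Sum>i=1..r. a i ^ k *\<^sub>R c i) * (\<Sum>i=1..r. a i *\<^sub>R c i)
      = (\<Sum>i=1..r. (\<Sum>j=1..r. a j ^ k *\<^sub>R c j) * (a i *\<^sub>R c i))"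
    by (rule jordan_sum)
  also have "\<dots> = (\<Sum>i=1..r. a i ^ Suc k *\<^sub>R c i)"
  proof (rule sum.cong)
    fix i assume i: "i \<in> {1..r}"
    show "(\<Sum>j=1..r. a j ^ k *\<^sub>R c j) * (a i *\<^sub>R c i) = a i ^ Suc k *\<^sub>R c i"
      using frame_mult_sum[OF assms i, of "\<lambda>j. a j ^ k"]
      by (simp add: jordan_simps jordan_commute[of _ "c i"])
  qed simp
  finally show ?case using Suc by (simp add: jordan_commute)
qed

text \<open>Frame sums multiply coordinatewise, so polynomials in \<open>x\<close> are evaluated at
  the \<open>a i\<close>. Vanishing of the coefficients from \<open>k\<close> on encodes degree
  below \<open>k\<close>, including the zero polynomial and \<open>k = 0\<close>.\<close>

lemma frame_span_powers:
  fixes c :: "nat \<Rightarrow> 'a::jordan_algebra"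
  assumes c: "jordan_frame r c" and x: "x = (\<Sum>i=1..r. a i *\<^sub>R c i)"
  shows "y \<in> span {x ^ i |i. i < k} \<longleftrightarrow>
    (\<exists>q. (\<forall>j\<ge>k. coeff q j = 0) \<and> y = (\<Sum>i=1..r. poly q (a i) *\<^sub>R c i))"
proof
  assume "y \<in> span {x ^ i |i. i < k}"
  then show "\<exists>q. (\<forall>j\<ge>k. coeff q j = 0) \<and> y = (\<Sum>i=1..r. poly q (a i) *\<^sub>R c i)"
  proof (induction rule: span_induct_alt)
    case base
    show ?case by (rule exI[of _ 0]) simp
  next
    case (step t u v)
    then obtain n q where "n < k" "u = x ^ n" "\<forall>j\<ge>k. coeff q j = 0"
      "v = (\<Sum>i=1..r. poly q (a i) *\<^sub>R c i)" by blast
    then show ?case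
      by (intro exI[of _ "monom t n + q"])
        (auto simp: x frame_power[OF c, unfolded One_nat_def] poly_monom scaleR_add_left sum.distrib scaleR_sum_right)
  qed
next
  assume "\<exists>q. (\<forall>j\<ge>k. coeff q j = 0) \<and> y = (\<Sum>i=1..r. poly q (a i) *\<^sub>R c i)"
  then obtain q where q: "\<forall>j\<ge>k. coeff q j = 0" "y = (\<Sum>i=1..r. poly q (a i) *\<^sub>R c i)" by blast
  have "poly q t = (\<Sum>j<k. coeff q j * t ^ j)" for t
  proof -
    have "(\<Sum>j\<le>degree q. coeff q j * t ^ j) = (\<Sum>j<k. coeff q j * t ^ j)"
      using q(1) by (intro sum.mono_neutral_cong) (auto simp: coeff_eq_0 not_less)
    then show ?thesis by (simp add: poly_altdef)
  qed
  then have "y = (\<Sum>i=1..r. \<Sum>j<k. coeff q j *\<^sub>R (a i ^ j *\<^sub>R c i))"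
    by (simp add: q(2) scaleR_sum_left)
  also have "\<dots> = (\<Sum>j<k. coeff q j *\<^sub>R x ^ j)"
    by (subst sum.swap) (simp add: x frame_power[OF c, unfolded One_nat_def] scaleR_sum_right)
  also have "\<dots> \<in> span {x ^ i |i. i < k}"
    by (intro span_sum span_scale span_base) auto
  finally show "y \<in> span {x ^ i |i. i < k}" .
qed

lemma frame_poly_eq_0:
  assumes "inj_on a {1..r}" "\<And>i. i \<in> {1..r} \<Longrightarrow> poly p (a i) = (0::real)" "\<And>j. r \<le> j \<Longrightarrow> coeff p j = 0"
  shows "p = 0"
proof (rule ccontr)
  assume p: "p \<noteq> 0"
  have "card (a ` {1..r}) \<le> card {t. poly p t = 0}"
    using assms(2) p by (intro card_mono poly_roots_finite) auto
  also have "\<dots> \<le> degree p" by (rule card_poly_roots_bound[OF p])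
  finally have "r \<le> degree p" using assms(1) by (simp add: card_image)
  then show False using assms(3) p by (metis leading_coeff_0_iff)
qed

lemma frame_min_poly_degree:
  fixes c :: "nat \<Rightarrow> 'a::jordan_algebra"
  assumes c: "jordan_frame r c" and a: "inj_on a {1..r}" and x: "x = (\<Sum>i=1..r. a i *\<^sub>R c i)"
  shows "min_poly_degree x = r"
  unfolding min_poly_degree_def
proof (rule Least_equality)
  let ?Q = "\<Prod>i\<in>{1..r}. [:- a i, 1:]"
  have Q: "coeff ?Q r = 1" "\<And>j. j > r \<Longrightarrow> coeff ?Q j = 0"
    using coeff_prod_linear[of "{1..r}" a] by auto
  have "poly ?Q (a i) = 0" if "i \<in> {1..r}" for i
    using that by (auto simp: poly_prod)
  \<comment> \<open>Subtracting the monic \<open>?Q\<close>, which vanishes at every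
    \<open>a i\<close>, lowers the degree below \<open>r\<close> without changing the
    values.\<close>
  then have "x ^ r = (\<Sum>i=1..r. poly (monom 1 r - ?Q) (a i) *\<^sub>R c i)"
    by (auto simp: x frame_power[OF c, unfolded One_nat_def] poly_monom intro!: sum.cong)
  moreover have "coeff (monom 1 r - ?Q) j = 0" if "j \<ge> r" for j
    using Q that by (cases "j = r") auto
  ultimately show "x ^ r \<in> span {x ^ i |i. i < r}"
    unfolding frame_span_powers[OF c x] by blast
next
  fix k assume "x ^ k \<in> span {x ^ i |i. i < k}"
  then obtain q where q: "\<forall>j\<ge>k. coeff q j = 0" "x ^ k = (\<Sum>i=1..r. poly q (a i) *\<^sub>R c i)"
    unfolding frame_span_powers[OF c x] by blast
  show "r \<le> k"
  proof (rule ccontr)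
    assume "\<not> r \<le> k"
    have "(\<Sum>i=1..r. poly (monom 1 k - q) (a i) *\<^sub>R c i) = 0"
      using q(2) by (simp add: x frame_power[OF c, unfolded One_nat_def] poly_monom scaleR_diff_left sum_subtractf)
    then have "\<forall>i\<in>{1..r}. poly (monom 1 k - q) (a i) = 0" unfolding frame_sum_eq_0_iff[OF c] .
    moreover have "coeff (monom 1 k - q) j = 0" if "r \<le> j" for j
      using q(1) that \<open>\<not> r \<le> k\<close> by simp
    ultimately have "monom 1 k - q = 0" using frame_poly_eq_0[OF a] by blast
    then have "coeff (monom 1 k - q) k = 0" by simp
    then show False using q(1) by simp
  qed
qed

text \<open>For distinct \<open>a i\<close> the element is regular and its minimal polynomial is the
  product of the X - \<open>a i\<close>; the trace is minus the subleading coefficient.\<close>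

lemma frame_trace_sum:
  fixes c :: "nat \<Rightarrow> 'a::euclidean_jordan_algebra"
  assumes tr: "is_jordan_trace tr" and r: "jordan_rank TYPE('a) = r" "r > 0"
    and c: "jordan_frame r c" and a: "inj_on a {1..r}"
  shows "tr (\<Sum>i=1..r. a i *\<^sub>R c i) = sum a {1..r}"
proof -
  define x where x: "x = (\<Sum>i=1..r. a i *\<^sub>R c i)"
  let ?Q = "\<Prod>i\<in>{1..r}. [:- a i, 1:]"
  obtain n where n: "r = Suc n" using r(2) by (cases r) auto
  have Q: "coeff ?Q r = 1" "\<And>j. j > r \<Longrightarrow> coeff ?Q j = 0" "coeff ?Q n = - sum a {1..r}"
    using coeff_prod_linear[of "{1..r}" a] n by auto
  have Q0: "poly ?Q (a i) = 0" if "i \<in> {1..r}" for i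
    using that by (auto simp: poly_prod)
  have "regular_element x"
    unfolding regular_element_def r(1) by (rule frame_min_poly_degree[OF c a x])
  then have "x ^ r - tr x *\<^sub>R x ^ n \<in> span {x ^ i |i. i < n}"
    using tr unfolding is_jordan_trace_def r(1) by (simp add: n)
  then obtain q where q: "\<forall>j\<ge>n. coeff q j = 0"
    "x ^ r - tr x *\<^sub>R x ^ n = (\<Sum>i=1..r. poly q (a i) *\<^sub>R c i)"
    unfolding frame_span_powers[OF c x] by blast
  \<comment> \<open>The monic relation of degree \<open>r\<close> supplied by \<open>tr\<close>. It
    shares \<open>r\<close> distinct roots with \<open>?Q\<close>, so the two agree.\<close>
  define p where "p = monom 1 r - monom (tr x) n - q"
  have "(\<Sum>i=1..r. poly p (a i) *\<^sub>R c i) = 0"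
    using q(2) unfolding p_def x frame_power[OF c]
    by (simp add: poly_monom scaleR_diff_left sum_subtractf scaleR_sum_right)
  then have "\<forall>i\<in>{1..r}. poly p (a i) = 0" unfolding frame_sum_eq_0_iff[OF c] .
  then have "poly (p - ?Q) (a i) = 0" if "i \<in> {1..r}" for i using that Q0 by simp
  moreover have "coeff (p - ?Q) j = 0" if "r \<le> j" for j
    using that Q(1,2) q(1) by (cases "j = r") (auto simp: p_def n)
  ultimately have "p - ?Q = 0" by (rule frame_poly_eq_0[OF a])
  then have "coeff p n = - sum a {1..r}" using Q(3) by simp
  then have "tr x = sum a {1..r}" using q(1) by (simp add: p_def n)
  then show ?thesis unfolding x .
qed

lemma frame_trace:
  fixes c :: "nat \<Rightarrow> 'a::euclidean_jordan_algebra"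
  assumes tr: "is_jordan_trace tr" and r: "jordan_rank TYPE('a) = r"
    and c: "jordan_frame r c" and j: "j \<in> {1..r}"
  shows "tr (c j) = 1"
proof -
  have r0: "r > 0" using j by simp
  have lin: "linear tr" using tr by (simp add: is_jordan_trace_def)
  have tr_sum: "(\<Sum>i=1..r. a i * tr (c i)) = sum a {1..r}" if "inj_on a {1..r}" for a
    using frame_trace_sum[OF tr r r0 c that] by (simp add: linear_sum[OF lin] linear_scale[OF lin])
  \<comment> \<open>\<open>frame_trace_sum\<close> requires injective coefficients. The sequences 1,
    ..., \<open>r\<close> and \<open>b\<close> are both injective and differ in entry
    \<open>j\<close> alone, so subtraction isolates \<open>tr (c j)\<close>.\<close>
  define b where "b = (\<lambda>i. if i = j then real (r + 1) else real i)"
  have "inj_on b {1..r}" by (auto simp: inj_on_def b_def)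
  from tr_sum[OF this] tr_sum[of real]
  have "(\<Sum>i=1..r. (b i - real i) * tr (c i)) = (\<Sum>i=1..r. b i - real i)"
    by (simp add: left_diff_distrib sum_subtractf)
  also have "(\<Sum>i=1..r. (b i - real i) * tr (c i)) = (\<Sum>i=1..r. if i = j then (real (r + 1) - real j) * tr (c j) else 0)"
    by (intro sum.cong) (auto simp: b_def)
  also have "\<dots> = (real (r + 1) - real j) * tr (c j)" using j by simp
  also have "(\<Sum>i=1..r. b i - real i) = (\<Sum>i=1..r. if i = j then real (r + 1) - real j else 0)"
    by (intro sum.cong) (auto simp: b_def)
  also have "\<dots> = real (r + 1) - real j" using j by simp
  finally show ?thesis using j by simp
qed

section \<open>One-parameter groups of automorphisms\<close>

lemma blinfun_power_apply:
  fixes D :: "'a::real_normed_vector \<Rightarrow>\<^sub>L 'a"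
  shows "blinfun_apply ((((o\<^sub>L) D) ^^ n) id_blinfun) x = (blinfun_apply D ^^ n) x"
  by (induction n arbitrary: x) simp_all

lemma norm_blinfun_power_le:
  fixes D :: "'a::real_normed_vector \<Rightarrow>\<^sub>L 'a"
  shows "norm ((((o\<^sub>L) D) ^^ n) id_blinfun) \<le> norm D ^ n"
proof (induction n)
  case 0
  show ?case by (simp add: norm_blinfun_id_le)
next
  case (Suc n)
  have "norm (D o\<^sub>L (((o\<^sub>L) D) ^^ n) id_blinfun) \<le> norm D * norm ((((o\<^sub>L) D) ^^ n) (id_blinfun :: 'a \<Rightarrow>\<^sub>L 'a))"
    by (rule norm_blinfun_compose)
  also have "\<dots> \<le> norm D * norm D ^ n" using Suc by (intro mult_left_mono) auto
  finally show ?case by simp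
qed

lemma summable_op_exp:
  fixes D :: "'a::euclidean_space \<Rightarrow>\<^sub>L 'a"
  shows "summable (\<lambda>n. (1 / fact n) *\<^sub>R (((o\<^sub>L) D) ^^ n) id_blinfun)"
proof (rule summable_comparison_test')
  show "summable (\<lambda>n. norm D ^ n /\<^sub>R fact n)" by (rule summable_exp_generic)
  show "norm ((1 / fact n) *\<^sub>R (((o\<^sub>L) D) ^^ n) (id_blinfun :: 'a \<Rightarrow>\<^sub>L 'a)) \<le> norm D ^ n /\<^sub>R fact n" for n
    using norm_blinfun_power_le[of n D] by (simp add: field_simps)
qed

lemma op_exp_sums:
  fixes D :: "'a::euclidean_space \<Rightarrow>\<^sub>L 'a"
  shows "(\<lambda>n. (1 / fact n) *\<^sub>R (blinfun_apply D ^^ n) x) sums blinfun_apply (op_exp D) x"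
  using bounded_linear.sums[OF blinfun.bounded_linear_left summable_sums[OF summable_op_exp[of D]], of x]
  by (simp add: op_exp_def blinfun.bilinear_simps blinfun_power_apply)

lemma op_exp_scaleR_sums:
  fixes D :: "'a::euclidean_space \<Rightarrow>\<^sub>L 'a"
  shows "(\<lambda>n. (t ^ n / fact n) *\<^sub>R (blinfun_apply D ^^ n) x) sums blinfun_apply (op_exp (t *\<^sub>R D)) x"
proof -
  have "(blinfun_apply (t *\<^sub>R D) ^^ n) x = t ^ n *\<^sub>R (blinfun_apply D ^^ n) x" for n
    by (induction n) (simp_all add: blinfun.bilinear_simps)
  then show ?thesis using op_exp_sums[of "t *\<^sub>R D" x] by simp
qed

lemma op_exp_commute:
  fixes D :: "'a::euclidean_space \<Rightarrow>\<^sub>L 'a"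
  shows "blinfun_apply (op_exp (t *\<^sub>R D)) (blinfun_apply D x) = blinfun_apply D (blinfun_apply (op_exp (t *\<^sub>R D)) x)"
proof -
  have "(\<lambda>n. (t ^ n / fact n) *\<^sub>R (blinfun_apply D ^^ n) (blinfun_apply D x)) sums
      blinfun_apply D (blinfun_apply (op_exp (t *\<^sub>R D)) x)"
    using bounded_linear.sums[OF blinfun.bounded_linear_right op_exp_scaleR_sums[of t D x], of D]
    by (simp add: blinfun.bilinear_simps funpow_swap1)
  then show ?thesis using op_exp_scaleR_sums[of t D "blinfun_apply D x"] sums_unique2 by blast
qed

text \<open>Each component is a real power series in \<open>t\<close>; differentiating it termwise
  replaces \<open>x\<close> by \<open>blinfun_apply D x\<close> in the coefficients.\<close>

lemma op_exp_has_vector_derivative: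
  fixes D :: "'a::euclidean_space \<Rightarrow>\<^sub>L 'a"
  shows "((\<lambda>t. blinfun_apply (op_exp (t *\<^sub>R D)) x) has_vector_derivative
           blinfun_apply D (blinfun_apply (op_exp (t *\<^sub>R D)) x)) (at t)"
  unfolding has_vector_derivative_def
proof (subst has_derivative_componentwise_within, intro ballI)
  fix y :: 'a
  have sums: "(\<lambda>n. (1 / fact n * ((blinfun_apply D ^^ n) x \<bullet> y)) * t ^ n) sums
      (blinfun_apply (op_exp (t *\<^sub>R D)) x \<bullet> y)" for t x
    using bounded_linear.sums[OF bounded_linear_inner_left op_exp_scaleR_sums[of t D x], of y]
    by (simp add: algebra_simps)
  define a where "a = (\<lambda>n. 1 / fact n * ((blinfun_apply D ^^ n) x \<bullet> y))"
  have diffs: "diffs a = (\<lambda>n. 1 / fact n * ((blinfun_apply D ^^ n) (blinfun_apply D x) \<bullet> y))"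
    unfolding diffs_def a_def by (rule ext) (simp add: funpow_swap1)
  have "((\<lambda>t. \<Sum>n. a n * t ^ n) has_field_derivative (\<Sum>n. diffs a n * t ^ n)) (at t)"
    by (rule termdiffs_strong_converges_everywhere)
      (use sums in \<open>auto simp: a_def sums_iff\<close>)
  then have "((\<lambda>t. blinfun_apply (op_exp (t *\<^sub>R D)) x \<bullet> y) has_field_derivative
      (blinfun_apply D (blinfun_apply (op_exp (t *\<^sub>R D)) x) \<bullet> y)) (at t)"
    using sums[of x] sums[of "blinfun_apply D x" t] unfolding diffs unfolding a_def
    by (simp add: sums_iff op_exp_commute)
  then show "((\<lambda>t. blinfun_apply (op_exp (t *\<^sub>R D)) x \<bullet> y) has_derivative
      (\<lambda>s. (s *\<^sub>R blinfun_apply D (blinfun_apply (op_exp (t *\<^sub>R D)) x)) \<bullet> y)) (at t)"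
    by (simp add: has_field_derivative_def mult_commute_abs)
qed

lemma op_exp_zero: "op_exp (0 :: 'a::euclidean_space \<Rightarrow>\<^sub>L 'a) = id_blinfun"
proof (rule blinfun_eqI)
  fix x :: 'a
  have "(\<lambda>n. (0 ^ n / fact n) *\<^sub>R (blinfun_apply 0 ^^ n) x) sums (\<Sum>n\<in>{0}. (0 ^ n / fact n) *\<^sub>R (blinfun_apply 0 ^^ n) x)"
    by (rule sums_finite) auto
  then show "blinfun_apply (op_exp 0) x = blinfun_apply id_blinfun x"
    using op_exp_scaleR_sums[of 0 0 x] sums_unique2 by fastforce
qed

text \<open>The difference of two solutions has constant norm, because \<open>D\<close> is skew.\<close>

lemma skew_ode_unique:
  fixes D :: "'a::euclidean_space \<Rightarrow>\<^sub>L 'a"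
  assumes skew: "\<And>x y. blinfun_apply D x \<bullet> y = - (x \<bullet> blinfun_apply D y)"
    and u: "\<And>t. (u has_vector_derivative blinfun_apply D (u t)) (at t)"
    and v: "\<And>t. (v has_vector_derivative blinfun_apply D (v t)) (at t)"
    and "u 0 = v 0"
  shows "u t = v (t::real)"
proof -
  define w where "w = (\<lambda>t. u t - v t)"
  have w: "(w has_vector_derivative blinfun_apply D (w t)) (at t)" for t
    unfolding w_def using has_vector_derivative_diff[OF u v] by (simp add: blinfun.bilinear_simps)
  have "((\<lambda>t. w t \<bullet> w t) has_real_derivative 0) (at t)" for t
  proof -
    have "((\<lambda>t. w t \<bullet> w t) has_vector_derivative w t \<bullet> blinfun_apply D (w t) + blinfun_apply D (w t) \<bullet> w t) (at t)"
      by (rule bounded_bilinear.has_vector_derivative[OF bounded_bilinear_inner w w])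
    then show ?thesis using skew[of "w t" "w t"] by (simp add: has_real_derivative_iff_has_vector_derivative)
  qed
  then have "w t \<bullet> w t = w 0 \<bullet> w 0"
    using DERIV_isconst_all[of "\<lambda>t. w t \<bullet> w t"] by blast
  then show ?thesis using assms(4) by (simp add: w_def)
qed

section \<open>Exponentials of derivations are automorphisms that preserve the orbit and its
  sphere\<close>

context
  fixes D :: "'a::euclidean_jordan_algebra \<Rightarrow>\<^sub>L 'a"
  assumes D: "D \<in> derivations"
begin

text \<open>Both sides solve u' = Du with initial value \<open>x * y\<close>; for the right side
  this is the product rule.\<close>

lemma op_exp_mult:
  "blinfun_apply (op_exp (t *\<^sub>R D)) (x * y) = blinfun_apply (op_exp (t *\<^sub>R D)) x * blinfun_apply (op_exp (t *\<^sub>R D)) y"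
proof (rule skew_ode_unique[OF derivation_skew[OF D]])
  show "((\<lambda>t. blinfun_apply (op_exp (t *\<^sub>R D)) x * blinfun_apply (op_exp (t *\<^sub>R D)) y) has_vector_derivative
      blinfun_apply D (blinfun_apply (op_exp (t *\<^sub>R D)) x * blinfun_apply (op_exp (t *\<^sub>R D)) y)) (at t)" for t
    using bounded_bilinear.has_vector_derivative[OF bounded_bilinear_jordan
        op_exp_has_vector_derivative[of D x t] op_exp_has_vector_derivative[of D y t]] D
    by (simp add: derivations_def add.commute)
qed (simp_all add: op_exp_has_vector_derivative op_exp_zero)

lemma op_exp_add:
  "blinfun_apply (op_exp (s *\<^sub>R D)) (blinfun_apply (op_exp (t *\<^sub>R D)) x) = blinfun_apply (op_exp ((s + t) *\<^sub>R D)) x"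
proof (rule skew_ode_unique[OF derivation_skew[OF D],
      where u = "\<lambda>s. blinfun_apply (op_exp (s *\<^sub>R D)) (blinfun_apply (op_exp (t *\<^sub>R D)) x)"
        and v = "\<lambda>s. blinfun_apply (op_exp ((s + t) *\<^sub>R D)) x" and t = s])
  show "((\<lambda>s. blinfun_apply (op_exp ((s + t) *\<^sub>R D)) x) has_vector_derivative
      blinfun_apply D (blinfun_apply (op_exp ((s + t) *\<^sub>R D)) x)) (at s)" for s
  proof -
    have "((\<lambda>s. s + t) has_vector_derivative 1) (at s)" by (auto intro!: derivative_eq_intros)
    from vector_diff_chain_at[OF this op_exp_has_vector_derivative[of D x "s + t"]]
    show ?thesis by (simp add: o_def)
  qed
qed (simp_all add: op_exp_has_vector_derivative op_exp_zero)

lemma op_exp_inverse: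
  "blinfun_apply (op_exp ((- t) *\<^sub>R D)) (blinfun_apply (op_exp (t *\<^sub>R D)) x) = x"
  "blinfun_apply (op_exp (t *\<^sub>R D)) (blinfun_apply (op_exp ((- t) *\<^sub>R D)) x) = x"
  unfolding op_exp_add by (simp_all add: op_exp_zero)

lemma bij_op_exp: "bij (blinfun_apply (op_exp (t *\<^sub>R D)))"
  by (rule o_bij[of "blinfun_apply (op_exp ((- t) *\<^sub>R D))"]) (auto simp del: scaleR_minus_left simp: op_exp_inverse)

lemma inv_op_exp: "inv (blinfun_apply (op_exp (t *\<^sub>R D))) = blinfun_apply (op_exp ((- t) *\<^sub>R D))"
  by (rule inv_unique_comp) (auto simp del: scaleR_minus_left simp: op_exp_inverse)

lemma op_exp_inner:
  "blinfun_apply (op_exp (t *\<^sub>R D)) x \<bullet> blinfun_apply (op_exp (t *\<^sub>R D)) y = x \<bullet> y"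
proof -
  have "((\<lambda>t. blinfun_apply (op_exp (t *\<^sub>R D)) x \<bullet> blinfun_apply (op_exp (t *\<^sub>R D)) y) has_real_derivative 0) (at t)" for t
    using bounded_bilinear.has_vector_derivative[OF bounded_bilinear_inner
        op_exp_has_vector_derivative[of D x t] op_exp_has_vector_derivative[of D y t]]
      derivation_skew[OF D] by (simp add: has_real_derivative_iff_has_vector_derivative)
  from DERIV_isconst_all[OF allI[OF this], of t 0] show ?thesis by (simp add: op_exp_zero)
qed

lemma norm_op_exp: "norm (blinfun_apply (op_exp (t *\<^sub>R D)) x) = norm x"
  by (simp add: norm_eq_sqrt_inner op_exp_inner)

text \<open>The exponential is an orthogonal automorphism: its adjoint is its inverse, and
  conjugation by it transports \<open>quad_rep\<close>.\<close>

lemma op_exp_compose_structure_group: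
  assumes g: "g \<in> structure_group"
  shows "op_exp (t *\<^sub>R D) o\<^sub>L g \<in> structure_group"
proof -
  let ?E = "blinfun_apply (op_exp (t *\<^sub>R D))" and ?F = "blinfun_apply (op_exp ((- t) *\<^sub>R D))"
  have lin: "linear (blinfun_apply h)" for h :: "'a \<Rightarrow>\<^sub>L 'a"
    by (simp add: blinfun.bounded_linear_right bounded_linear.linear)
  have adj: "adjoint (?E \<circ> blinfun_apply g) = adjoint (blinfun_apply g) \<circ> ?F"
  proof (rule adjoint_unique, intro allI)
    fix x y
    have "(?E \<circ> blinfun_apply g) x \<bullet> y = ?E (blinfun_apply g x) \<bullet> ?E (?F y)"
      by (simp only: op_exp_inverse o_def)
    also have "\<dots> = blinfun_apply g x \<bullet> ?F y" by (rule op_exp_inner)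
    also have "\<dots> = x \<bullet> adjoint (blinfun_apply g) (?F y)"
      using adjoint_works[OF lin, of x g "?F y"] by (simp add: inner_commute)
    finally show "(?E \<circ> blinfun_apply g) x \<bullet> y = x \<bullet> (adjoint (blinfun_apply g) \<circ> ?F) y" by simp
  qed
  have quad: "quad_rep (?E x) z = ?E (quad_rep x (?F z))" for x z
    using op_exp_inverse(2)[of t z] unfolding quad_rep_def quad_rep2_def
    by (simp add: blinfun.bilinear_simps op_exp_mult)
  have "bij (blinfun_apply (op_exp (t *\<^sub>R D) o\<^sub>L g))"
    using g bij_op_exp[of t] bij_comp unfolding structure_group_def blinfun_apply_blinfun_compose[abs_def] by (auto simp: comp_def)
  moreover have "quad_rep (blinfun_apply (op_exp (t *\<^sub>R D) o\<^sub>L g) x) =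
      blinfun_apply (op_exp (t *\<^sub>R D) o\<^sub>L g) \<circ> quad_rep x \<circ> adjoint (blinfun_apply (op_exp (t *\<^sub>R D) o\<^sub>L g))" for x
  proof -
    have "blinfun_apply (op_exp (t *\<^sub>R D) o\<^sub>L g) = ?E \<circ> blinfun_apply g" by (rule ext) simp
    moreover have "quad_rep (blinfun_apply g x) = blinfun_apply g \<circ> quad_rep x \<circ> adjoint (blinfun_apply g)"
      using g by (simp add: structure_group_def)
    ultimately show ?thesis by (simp only: adj) (simp add: fun_eq_iff quad)
  qed
  ultimately show ?thesis unfolding structure_group_def by blast
qed

text \<open>The curve \<open>op_exp (t *\<^sub>R D) o\<^sub>L g\<close> is connected, stays in the
  structure group and passes through \<open>g\<close> at \<open>t = 0\<close>, so it remains in the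
  identity component.\<close>

lemma op_exp_Xi_orbit:
  assumes "x \<in> Xi_orbit c1"
  shows "blinfun_apply (op_exp (t *\<^sub>R D)) x \<in> Xi_orbit c1"
proof -
  obtain g where g: "connected_component structure_group id_blinfun g" and x: "x = blinfun_apply g c1"
    using assms by (auto simp: Xi_orbit_def structure_group0_def)
  define K where "K = range (\<lambda>t. op_exp (t *\<^sub>R D) o\<^sub>L g)"
  have "g \<in> structure_group" using g connected_component_in by blast
  then have "K \<subseteq> structure_group" unfolding K_def using op_exp_compose_structure_group by blast
  moreover have "connected K" unfolding K_def
  proof (rule connected_continuous_image)
    show "continuous_on UNIV (\<lambda>t. op_exp (t *\<^sub>R D) o\<^sub>L g)"
      by (rule continuous_on_blinfun_componentwise)
        (use op_exp_has_vector_derivative[of D] in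
          \<open>auto intro!: continuous_at_imp_continuous_on has_vector_derivative_continuous\<close>)
  qed simp
  moreover have "g \<in> K"
  proof -
    have "op_exp (0 *\<^sub>R D) o\<^sub>L g = g" by (rule blinfun_eqI) (simp add: op_exp_zero)
    then show ?thesis unfolding K_def by (metis rangeI)
  qed
  moreover have "op_exp (t *\<^sub>R D) o\<^sub>L g \<in> K" unfolding K_def by blast
  ultimately have "connected_component structure_group g (op_exp (t *\<^sub>R D) o\<^sub>L g)"
    unfolding connected_component_def by blast
  with g have "op_exp (t *\<^sub>R D) o\<^sub>L g \<in> structure_group0"
    unfolding structure_group0_def using connected_component_trans by fastforce
  then show ?thesis unfolding Xi_orbit_def x by force
qed

lemma op_exp_Xi_sphere:
  "x \<in> Xi_sphere c1 \<Longrightarrow> blinfun_apply (op_exp (t *\<^sub>R D)) x \<in> Xi_sphere c1"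
  by (simp add: Xi_sphere_def op_exp_Xi_orbit norm_op_exp)

end

section \<open>Complexified vectors and operators\<close>

text \<open>The complex-linear action of A + iB on the complexified space.\<close>

definition capply :: "('a::real_normed_vector \<Rightarrow>\<^sub>L 'a) \<times> ('a \<Rightarrow>\<^sub>L 'a) \<Rightarrow> 'a \<times> 'a \<Rightarrow> 'a \<times> 'a" where
  "capply Z u = (blinfun_apply (fst Z) (fst u) - blinfun_apply (snd Z) (snd u),
                 blinfun_apply (fst Z) (snd u) + blinfun_apply (snd Z) (fst u))"

lemma bracket_apply:
  "blinfun_apply (bracket X Y) v = blinfun_apply X (blinfun_apply Y v) - blinfun_apply Y (blinfun_apply X v)"
  by (simp add: bracket_def blinfun.diff_left)

lemma bracket_simps [simp]: "bracket X 0 = 0" "bracket 0 X = 0" "bracket X (- Y) = - bracket X Y"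
  by (rule blinfun_eqI; simp add: bracket_apply blinfun.bilinear_simps)+

lemma capply_add: "capply (Z + W) u = capply Z u + capply W u"
  by (simp add: capply_def blinfun.bilinear_simps)

lemma capply_cscale: "capply (cscale z Z) u = cscale z (capply Z u)"
  by (simp add: capply_def cscale_def blinfun.bilinear_simps scaleR_diff_right scaleR_add_right)

lemma capply_cscale_right: "capply Z (cscale z u) = cscale z (capply Z u)"
  by (simp add: capply_def cscale_def blinfun.bilinear_simps scaleR_diff_right scaleR_add_right)

lemma capply_cbracket: "capply (cbracket Z W) u = capply Z (capply W u) - capply W (capply Z u)"
  by (simp add: capply_def cbracket_def bracket_apply blinfun.bilinear_simps)

lemma cscale_cscale: "cscale z (cscale z' u) = cscale (z * z') u"
  by (simp add: cscale_def scaleR_diff_right scaleR_add_right scaleR_diff_left scaleR_add_left algebra_simps)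

lemma cscale_add_left: "cscale (z + z') u = cscale z u + cscale z' u"
  by (simp add: cscale_def scaleR_add_left)

lemma cbilinear_cvec: "cbilinear (cvec x) w = Complex (x \<bullet> fst w) (x \<bullet> snd w)"
  by (simp add: cbilinear_def cvec_def)

lemma cbilinear_add_right: "cbilinear u (v + w) = cbilinear u v + cbilinear u w"
  by (simp add: cbilinear_def inner_add_right complex_eq_iff)

lemma cbilinear_cscale_right: "cbilinear u (cscale z v) = z * cbilinear u v"
  by (simp add: cbilinear_def cscale_def inner_add_right inner_diff_right complex_eq_iff algebra_simps)

lemma cbilinear_sum_right: "cbilinear u (sum f A) = (\<Sum>i\<in>A. cbilinear u (f i))"
proof (induction A rule: infinite_finite_induct)
  case empty
  show ?case by (simp add: cbilinear_def complex_eq_iff)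
next
  case infinite
  then show ?case by (simp add: cbilinear_def complex_eq_iff)
qed (simp add: cbilinear_add_right)

lemma bounded_linear_cbilinear_cvec: "bounded_linear (\<lambda>x::'a::real_inner. cbilinear (cvec x) w)"
proof -
  have "bounded_linear (\<lambda>x. of_real (x \<bullet> fst w) + \<i> * of_real (x \<bullet> snd w))"
    by (rule bounded_linear_add[OF bounded_linear_compose[OF bounded_linear_of_real]
          bounded_linear_const_mult[OF bounded_linear_compose[OF bounded_linear_of_real]]])
      (rule bounded_linear_inner_left)+
  then show ?thesis by (simp add: cbilinear_cvec Complex_eq)
qed

section \<open>Powers of isotropic linear forms\<close>

text \<open>The constant \<open>k\<close> lets the formula apply again to a first derivative. At
  \<open>n = 0\<close> the factor \<open>of_nat n\<close> makes the truncated \<open>n - 1\<close>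
  harmless.\<close>

lemma partial_power:
  assumes "bounded_linear (l :: 'a::euclidean_space \<Rightarrow> complex)"
  shows "partial v (\<lambda>x. k * l x ^ n) x = k * of_nat n * l v * l x ^ (n - 1)"
proof -
  have "((\<lambda>x. k * l x ^ n) has_derivative (\<lambda>v. k * of_nat n * l v * l x ^ (n - 1))) (at x)"
    using has_derivative_mult_right[OF has_derivative_power[OF bounded_linear_imp_has_derivative[OF assms]], of k n x UNIV]
    by (simp add: mult_ac)
  then show ?thesis unfolding partial_def by (simp add: frechet_derivative_at[symmetric])
qed

lemma sum_Basis_cbilinear:
  "(\<Sum>a\<in>Basis. cbilinear (cvec a) w * cbilinear (cvec a) u) = cbilinear w (u :: 'a::euclidean_space \<times> 'a)"
proof -
  have "(\<Sum>a\<in>Basis. (a \<bullet> x) * (a \<bullet> y)) = x \<bullet> y" for x y :: 'a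
    using euclidean_inner[of x y] by (simp add: inner_commute)
  then show ?thesis
    by (simp add: cvec_def complex_eq_iff cbilinear_def sum_subtractf sum.distrib)
qed

text \<open>The hypotheses say that p + iq has square zero and is orthogonal to the unit; they
  dispose of the second-order and the first-order term respectively.\<close>

lemma bessel_unit_power:
  fixes p q :: "'a::euclidean_jordan_algebra"
  assumes iso: "p * p = q * q" "p * q = 0" and tr: "p \<bullet> 1 = 0" "q \<bullet> 1 = 0"
  shows "bessel_unit lam (\<lambda>x. cbilinear (cvec x) (p, q) ^ m) x = 0"
proof -
  define l where "l = (\<lambda>x. cbilinear (cvec x) (p, q))"
  have l: "bounded_linear l" unfolding l_def by (rule bounded_linear_cbilinear_cvec)
  define k where "k = of_nat m * of_nat (m - 1) * l x ^ (m - 2)"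
  have 1: "partial a (\<lambda>x. l x ^ m) x = of_nat m * l a * l x ^ (m - 1)" for a x
    using partial_power[OF l, of a 1 m x] by simp
  have 2: "partial a (partial b (\<lambda>x. l x ^ m)) x = k * (l a * l b)" for a b
  proof -
    have "partial b (\<lambda>x. l x ^ m) = (\<lambda>x. of_nat m * l b * l x ^ (m - 1))" by (rule ext) (rule 1)
    then show ?thesis using partial_power[OF l, of a "of_nat m * l b" "m - 1" x]
      by (simp add: k_def mult_ac numeral_2_eq_2)
  qed
  \<comment> \<open>When \<open>quad_rep2 a b x\<close> is paired with the unit, the terms
    \<open>b * (a * x)\<close> and \<open>(a * b) * x\<close> cancel.\<close>
  have quad: "cbilinear (cvec 1) (cvec (quad_rep2 a b x)) = cbilinear (cvec a) (cvec (b * x))" for a b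
  proof -
    have "1 \<bullet> (u * v) = u \<bullet> v" for u v :: 'a
      using inner_jordan[of 1 u v] by (simp add: jordan_unit)
    moreover have "b \<bullet> (a * x) = (a * b) \<bullet> x" by (simp add: inner_jordan_assoc)
    ultimately have "1 \<bullet> quad_rep2 a b x = a \<bullet> (b * x)"
      by (simp add: quad_rep2_def inner_add_right inner_diff_right)
    then show ?thesis by (simp add: cbilinear_def cvec_def)
  qed
  \<comment> \<open>Contraction over both basis indices replaces \<open>a\<close> and
    \<open>b\<close> by \<open>(p, q)\<close>, leaving the pairing of \<open>x\<close> with the
    square of p + iq.\<close>
  have "(\<Sum>a\<in>Basis. \<Sum>b\<in>Basis. k * (l a * l b) * cbilinear (cvec a) (cvec (b * x)))
      = k * (\<Sum>b\<in>Basis. l b * (\<Sum>a\<in>Basis. l a * cbilinear (cvec a) (cvec (b * x))))"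
    by (subst sum.swap) (simp add: sum_distrib_left mult_ac)
  also have "\<dots> = k * (\<Sum>b\<in>Basis. l b * cbilinear (p, q) (cvec (b * x)))"
    unfolding l_def by (simp only: sum_Basis_cbilinear)
  also have "\<dots> = k * (\<Sum>b\<in>Basis. l b * cbilinear (cvec b) (p * x, q * x))"
  proof -
    have "v \<bullet> (b * x) = b \<bullet> (v * x)" for v b
      by (metis inner_jordan inner_jordan_assoc)
    then show ?thesis by (simp add: cbilinear_def cvec_def)
  qed
  also have "(\<Sum>b\<in>Basis. l b * cbilinear (cvec b) (p * x, q * x)) = cbilinear (p, q) (p * x, q * x)"
    unfolding l_def by (rule sum_Basis_cbilinear)
  also have "\<dots> = 0"
  proof -
    have "u \<bullet> (v * x) = (u * v) \<bullet> x" for u v by (rule inner_jordan[symmetric])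
    then show ?thesis using iso by (simp add: cbilinear_def complex_eq_iff jordan_commute[of q p])
  qed
  finally have "(\<Sum>a\<in>Basis. \<Sum>b\<in>Basis. k * (l a * l b) * cbilinear (cvec a) (cvec (b * x))) = 0" by simp
  moreover have "(\<Sum>a\<in>Basis. l a * cbilinear (cvec 1) (cvec a)) = 0"
  proof -
    have "(\<Sum>a\<in>Basis. l a * cbilinear (cvec 1) (cvec a)) = (\<Sum>a\<in>Basis. l a * cbilinear (cvec a) (cvec 1))"
      by (simp add: cbilinear_def cvec_def inner_commute)
    also have "\<dots> = cbilinear (p, q) (cvec 1)" unfolding l_def by (rule sum_Basis_cbilinear)
    finally show ?thesis using tr by (simp add: cbilinear_def cvec_def complex_eq_iff)
  qed
  then have "(\<Sum>a\<in>Basis. of_nat m * l a * l x ^ (m - 1) * cbilinear (cvec 1) (cvec a)) = 0"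
    using sum_distrib_left[of "of_nat m * l x ^ (m - 1)" "\<lambda>a. l a * cbilinear (cvec 1) (cvec a)" Basis]
    by (simp add: mult_ac)
  moreover have "(\<lambda>x. cbilinear (cvec x) (p, q) ^ m) = (\<lambda>x. l x ^ m)" by (simp add: l_def)
  ultimately show ?thesis
    unfolding bessel_unit_def bessel_def
    by (simp only: cbilinear_add_right cbilinear_sum_right cbilinear_cscale_right 1 2 quad) simp
qed

lemma real_polynomial_function_complex_power:
  assumes "real_polynomial_function (\<lambda>x. Re (g x))" "real_polynomial_function (\<lambda>x. Im (g x))"
  shows "real_polynomial_function (\<lambda>x. Re (g x ^ m)) \<and> real_polynomial_function (\<lambda>x. Im (g x ^ m))"
proof (induction m)
  case 0
  show ?case by (simp add: real_polynomial_function.intros(2))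
next
  case (Suc m)
  then have "real_polynomial_function (\<lambda>x. Re (g x) * Re (g x ^ m) - Im (g x) * Im (g x ^ m))"
    "real_polynomial_function (\<lambda>x. Re (g x) * Im (g x ^ m) + Im (g x) * Re (g x ^ m))"
    using assms by (intro real_polynomial_function_diff real_polynomial_function.intros(3,4); blast)+
  then show ?case by simp
qed

lemma homogeneous_polynomial_power:
  "homogeneous_polynomial m (\<lambda>x. cbilinear (cvec x) w ^ m)"
proof -
  have "real_polynomial_function (\<lambda>x. x \<bullet> v)" for v :: 'a
    by (rule real_polynomial_function.intros(1)[OF bounded_linear_inner_left])
  then have "polynomial_function (\<lambda>x. cbilinear (cvec x) w ^ m)"
    unfolding polynomial_function_iff_Basis_inner Basis_complex_def
    using real_polynomial_function_complex_power[of "\<lambda>x. cbilinear (cvec x) w" m]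
    by (simp add: cbilinear_cvec inner_complex_def)
  moreover have "cbilinear (cvec (t *\<^sub>R x)) w = of_real t * cbilinear (cvec x) w" for t x
    by (simp add: cbilinear_cvec complex_eq_iff)
  ultimately show ?thesis unfolding homogeneous_polynomial_def by (simp add: power_mult_distrib)
qed

lemma power_in_harmonics_sphere:
  fixes p q :: "'a::euclidean_jordan_algebra"
  assumes "p * p = q * q" "p * q = 0" "p \<bullet> 1 = 0" "q \<bullet> 1 = 0"
  shows "restrict (\<lambda>x. cbilinear (cvec x) (p, q) ^ m) (Xi_sphere c1) \<in> harmonics_sphere lam c1 m"
proof -
  let ?f = "\<lambda>x. cbilinear (cvec x) (p, q) ^ m"
  have "restrict ?f (Xi_orbit c1) \<in> harmonics_Xi lam c1 m"
    unfolding harmonics_Xi_def using homogeneous_polynomial_power bessel_unit_power[OF assms] by blast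
  moreover have "restrict (restrict ?f (Xi_orbit c1)) (Xi_sphere c1) = restrict ?f (Xi_sphere c1)"
    by (auto simp: Xi_sphere_def restrict_def)
  ultimately show ?thesis unfolding harmonics_sphere_def by (intro image_eqI) simp_all
qed

text \<open>The inverse in the translation action differentiates to -Dx; skewness of
  \<open>D\<close> absorbs the sign and moves \<open>D\<close> onto \<open>w\<close>.\<close>

lemma lie_action_power:
  fixes w :: "'a::euclidean_jordan_algebra \<times> 'a"
  assumes D: "D \<in> derivations" and x: "x \<in> Xi_sphere c1"
  shows "lie_action (Xi_sphere c1) D (restrict (\<lambda>x. cbilinear (cvec x) w ^ m) (Xi_sphere c1)) x =
    of_nat m * cbilinear (cvec x) (capply (cvec D) w) * cbilinear (cvec x) w ^ (m - 1)"
proof -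
  let ?S = "Xi_sphere c1"
  let ?u = "\<lambda>t. blinfun_apply (op_exp ((- t) *\<^sub>R D)) x"
  let ?l = "\<lambda>x. cbilinear (cvec x) w"
  have tr: "translate ?S (op_exp (t *\<^sub>R D)) (restrict (\<lambda>x. ?l x ^ m) ?S) x = ?l (?u t) ^ m" for t
    unfolding translate_def inv_op_exp[OF D] using x op_exp_Xi_sphere[OF D x, of "- t"]
    by (simp del: scaleR_minus_left)
  have "((\<lambda>t. - t) has_vector_derivative - 1) (at (0::real))"
    by (auto intro!: derivative_eq_intros)
  from vector_diff_chain_at[OF this, of "\<lambda>t. blinfun_apply (op_exp (t *\<^sub>R D)) x"
      "blinfun_apply D (blinfun_apply (op_exp ((- 0) *\<^sub>R D)) x)"]
  have "(?u has_vector_derivative - blinfun_apply D x) (at 0)"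
    using op_exp_has_vector_derivative[of D x "- 0"] by (simp add: o_def op_exp_zero)
  then have "((\<lambda>t. ?l (?u t)) has_vector_derivative ?l (- blinfun_apply D x)) (at 0)"
    by (rule bounded_linear.has_vector_derivative[OF bounded_linear_cbilinear_cvec])
  moreover have "((\<lambda>z. z ^ m) has_field_derivative of_nat m * ?l (?u 0) ^ (m - 1)) (at (?l (?u 0)))"
    by (auto intro!: derivative_eq_intros)
  ultimately have "((\<lambda>z. z ^ m) \<circ> (\<lambda>t. ?l (?u t)) has_vector_derivative
      ?l (- blinfun_apply D x) * (of_nat m * ?l (?u 0) ^ (m - 1))) (at 0)"
    by (rule field_vector_diff_chain_at)
  then have "vector_derivative (\<lambda>t. ?l (?u t) ^ m) (at 0) =
      ?l (- blinfun_apply D x) * (of_nat m * ?l x ^ (m - 1))"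
    by (simp add: o_def op_exp_zero vector_derivative_at)
  moreover have "?l (- blinfun_apply D x) = cbilinear (cvec x) (capply (cvec D) w)"
    unfolding cbilinear_cvec using derivation_skew[OF D, of x] by (simp add: capply_def cvec_def)
  ultimately show ?thesis unfolding lie_action_def using x by (simp add: tr mult_ac)
qed

lemma lie_action_complex_power:
  fixes w :: "'a::euclidean_jordan_algebra \<times> 'a"
  assumes Z: "Z \<in> complexify derivations" and x: "x \<in> Xi_sphere c1"
  shows "lie_action_complex (Xi_sphere c1) Z (restrict (\<lambda>x. cbilinear (cvec x) w ^ m) (Xi_sphere c1)) x =
    of_nat m * cbilinear (cvec x) (capply Z w) * cbilinear (cvec x) w ^ (m - 1)"
proof -
  have "fst Z \<in> derivations" "snd Z \<in> derivations" using Z by (auto simp: complexify_def)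
  moreover have "cbilinear (cvec x) (capply Z w) =
      cbilinear (cvec x) (capply (cvec (fst Z)) w) + \<i> * cbilinear (cvec x) (capply (cvec (snd Z)) w)"
    unfolding cbilinear_cvec by (simp add: capply_def cvec_def complex_eq_iff inner_diff_right inner_add_right)
  ultimately show ?thesis
    unfolding lie_action_complex_def using x by (simp add: lie_action_power algebra_simps)
qed

section \<open>The operator \<open>[L(c\<^sub>1), L(x\<^sub>0)]\<close>\<close>

text \<open>\<open>a\<close>, \<open>b\<close>, \<open>q\<close> stand for c_1, c_2, x_0, with their
  norms in the trace form.\<close>

locale peirce_triple =
  fixes a b q :: "'a::euclidean_jordan_algebra"
  assumes primitive: "primitive_idempotent a" "primitive_idempotent b"
    and ab: "a * b = 0" and norms: "a \<bullet> a = 1" "b \<bullet> b = 1" "q \<bullet> q = 2"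
    and q: "a * q = (1/2) *\<^sub>R q" "b * q = (1/2) *\<^sub>R q"
begin

definition "X = bracket (mult_op a) (mult_op q)"

lemma aa: "a * a = a" and bb: "b * b = b" and ba: "b * a = 0"
  using primitive ab by (simp_all add: primitive_idempotent_def idempotent_def jordan_commute[of b a])

lemma idempotents: "idempotent a" "idempotent b" "idempotent (a + b)"
  by (simp_all add: idempotent_def jordan_simps aa bb ab ba)

lemma X_apply: "blinfun_apply X y = a * (q * y) - q * (a * y)"
proof -
  have "blinfun_apply (mult_op u) v = u * v" for u v :: 'a
    unfolding mult_op_def
    by (simp add: bounded_linear_Blinfun_apply bounded_bilinear.bounded_linear_right[OF bounded_bilinear_jordan])
  then show ?thesis by (simp add: X_def bracket_apply)
qed

text \<open>The parts of \<open>u * u\<close> along \<open>a\<close> and \<open>b\<close> are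
  multiples of these primitive idempotents; pairing with the idempotent determines the
  factor.\<close>

lemma off_diagonal_square:
  assumes u: "a * u = (1/2) *\<^sub>R u" "b * u = (1/2) *\<^sub>R u"
  shows "u * u = ((u \<bullet> u) / 2) *\<^sub>R (a + b)"
proof -
  have eu: "(a + b) * u = u" using u by (simp add: jordan_simps flip: scaleR_add_left)
  have coeff: "c * (u * u) = ((u \<bullet> u) / 2) *\<^sub>R c"
    if c: "primitive_idempotent c" "c \<bullet> c = 1" "c * u = (1/2) *\<^sub>R u" for c
  proof -
    have cc: "idempotent c" using c by (simp add: primitive_idempotent_def)
    obtain t where t: "c * (u * u) = t *\<^sub>R c"
      using primitive_peirce_one[OF c(1) peirce_half_square[OF cc c(3)]] by blast
    have "t = (c * (u * u)) \<bullet> c" using t c by simp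
    also have "\<dots> = (u * u) \<bullet> c" using cc by (simp add: inner_jordan_assoc idempotent_def)
    also have "\<dots> = u \<bullet> (c * u)" using inner_jordan[of u u c] by (simp add: jordan_commute)
    finally show ?thesis using t c by simp
  qed
  have "u * u = (a + b) * (u * u)"
    using peirce_one_commute[OF idempotents(3) eu, of u] eu by simp
  also have "\<dots> = ((u \<bullet> u) / 2) *\<^sub>R (a + b)"
    using coeff[OF primitive(1) norms(1) u(1)] coeff[OF primitive(2) norms(2) u(2)]
    by (simp add: jordan_simps scaleR_add_right)
  finally show ?thesis .
qed

lemma qq: "q * q = a + b"
  using off_diagonal_square[OF q] norms by simp

text \<open>Polarisation of \<open>off_diagonal_square\<close>.\<close>

lemma off_diagonal_orthogonal:
  assumes u: "a * u = (1/2) *\<^sub>R u" "b * u = (1/2) *\<^sub>R u" and orth: "q \<bullet> u = 0"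
  shows "q * u = 0"
proof -
  have "a * (q + u) = (1/2) *\<^sub>R (q + u)" "b * (q + u) = (1/2) *\<^sub>R (q + u)"
    using u q by (simp_all add: jordan_simps scaleR_add_right)
  from off_diagonal_square[OF this] off_diagonal_square[OF u] off_diagonal_square[OF q]
  have "q * u + u * q = 0"
    using orth by (simp add: jordan_simps inner_add_left inner_add_right inner_commute
        add_divide_distrib scaleR_add_left scaleR_add_right algebra_simps)
  then have "2 *\<^sub>R (q * u) = 0" by (simp add: scaleR_2 jordan_commute)
  then show ?thesis by simp
qed

text \<open>On the plane of \<open>a - b\<close> and \<open>q\<close> the operator generates a
  rotation, with eigenvalues \<plusminus>i/2.\<close>

lemma X_basis:
  "blinfun_apply X a = (-1/4) *\<^sub>R q" "blinfun_apply X b = (1/4) *\<^sub>R q"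
  "blinfun_apply X q = (1/2) *\<^sub>R (a - b)" "blinfun_apply X (a - b) = (-1/2) *\<^sub>R q"
proof -
  have qa: "q * a = (1/2) *\<^sub>R q" "q * b = (1/2) *\<^sub>R q" using q by (simp_all add: jordan_commute)
  show 1: "blinfun_apply X a = (-1/4) *\<^sub>R q"
    by (simp add: X_apply aa qa jordan_simps q flip: scaleR_diff_left)
  show 2: "blinfun_apply X b = (1/4) *\<^sub>R q"
    by (simp add: X_apply ab qa jordan_simps q)
  show "blinfun_apply X (a - b) = (-1/2) *\<^sub>R q"
  proof -
    have "blinfun_apply X (a - b) = (-1/4 - 1/4) *\<^sub>R q"
      by (simp only: blinfun.diff_right 1 2 scaleR_diff_left)
    then show ?thesis by simp
  qed
  have "blinfun_apply X q = a - (1/2) *\<^sub>R (a + b)"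
    by (simp add: X_apply qq q jordan_simps aa ab)
  also have "\<dots> = (1/2) *\<^sub>R (a - b)"
    using scaleR_diff_left[of 1 "1/2" a] by (simp add: scaleR_add_right scaleR_diff_right)
  finally show "blinfun_apply X q = (1/2) *\<^sub>R (a - b)" .
qed

text \<open>On the half Peirce space of \<open>a + b\<close> the doubled multiplications by \<open>a\<close> and \<open>q\<close>
  are a projection \<open>P\<close> and an involution \<open>Q\<close> with \<open>P Q + Q P = Q\<close>, so
  \<open>[P, Q]\<^sup>2 = -1\<close>.\<close>

lemma X_X_half:
  assumes h: "(a + b) * h = (1/2) *\<^sub>R h"
  shows "blinfun_apply X (blinfun_apply X h) = (-1/16) *\<^sub>R h"
proof -
  have a1: "(a + b) * a = a" and q1: "(a + b) * q = q"
    using q by (simp_all add: jordan_simps aa ba flip: scaleR_add_left)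
  have A: "a * (a * w) = (1/2) *\<^sub>R (a * w)" and Q: "q * (q * w) = (1/4) *\<^sub>R w"
    and AQ: "a * (q * w) = (1/2) *\<^sub>R (q * w) - q * (a * w)"
    if w: "(a + b) * w = (1/2) *\<^sub>R w" for w
  proof -
    have "a * (a * w) = (1/2) *\<^sub>R ((a * a) * w)"
      unfolding peirce_one_half_square[OF idempotents(3) a1 w] by simp
    then show "a * (a * w) = (1/2) *\<^sub>R (a * w)" by (simp only: aa)
    have "q * (q * w) = (1/2) *\<^sub>R ((q * q) * w)"
      unfolding peirce_one_half_square[OF idempotents(3) q1 w] by simp
    then show "q * (q * w) = (1/4) *\<^sub>R w" by (simp add: qq w)
    show "a * (q * w) = (1/2) *\<^sub>R (q * w) - q * (a * w)"
      using peirce_one_half_mult[OF idempotents(3) a1 q1 w] by (simp add: q jordan_simps)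
  qed
  have half: "(a + b) * (q * w) = (1/2) *\<^sub>R (q * w)" "(a + b) * (a * w) = (1/2) *\<^sub>R (a * w)"
    if w: "(a + b) * w = (1/2) *\<^sub>R w" for w
    using peirce_one_commute[OF idempotents(3) q1, of w] peirce_one_commute[OF idempotents(3) a1, of w] w
    by (simp_all add: jordan_simps(3))
  \<comment> \<open>This is the image of \<open>h\<close> under \<open>X\<close>, with
    \<open>a\<close> moved next to \<open>h\<close> by \<open>AQ\<close>.\<close>
  let ?k = "(1/2) *\<^sub>R (q * h) - 2 *\<^sub>R (q * (a * h))"
  have X: "blinfun_apply X w = (1/2) *\<^sub>R (q * w) - 2 *\<^sub>R (q * (a * w))"
    if "(a + b) * w = (1/2) *\<^sub>R w" for w
    using AQ[OF that] by (simp add: X_apply scaleR_2)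
  have k: "(a + b) * ?k = (1/2) *\<^sub>R ?k"
    using half(1)[OF h] half(1)[OF half(2)[OF h]] by (simp add: jordan_simps(3,7) scaleR_diff_right)
  have qk: "q * ?k = (1/8) *\<^sub>R h - (1/2) *\<^sub>R (a * h)"
    using Q[OF h] Q[OF half(2)[OF h]] by (simp add: jordan_simps(3,7))
  have "a * (q * ?k) = (1/8) *\<^sub>R (a * h) - (1/4) *\<^sub>R (a * h)"
    unfolding qk using A[OF h] by (simp add: jordan_simps(3,7))
  then have aqk: "a * (q * ?k) = (-1/8) *\<^sub>R (a * h)" by (simp flip: scaleR_diff_left)
  \<comment> \<open>Here \<open>AQ\<close> is used in the other direction, so that \<open>q\<close>
    meets \<open>?k\<close> first and \<open>qk\<close> applies.\<close>
  have "blinfun_apply X ?k = 2 *\<^sub>R (a * (q * ?k)) - (1/2) *\<^sub>R (q * ?k)"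
  proof -
    have "q * (a * ?k) = (1/2) *\<^sub>R (q * ?k) - a * (q * ?k)" using AQ[OF k] by simp
    then show ?thesis unfolding X_apply by (simp add: scaleR_2)
  qed
  also have "\<dots> = (-1/4) *\<^sub>R (a * h) - ((1/16) *\<^sub>R h - (1/4) *\<^sub>R (a * h))"
    by (subst aqk, subst qk, simp add: scaleR_diff_right)
  also have "\<dots> = (-1/16) *\<^sub>R h" by simp
  finally show ?thesis unfolding X[OF h] .
qed

text \<open>X^2 (16 X^2 + 1) annihilates the eigenvalues 0 and \<plusminus>i/4, so only the rotation
  plane survives. This is checked on the Peirce components of \<open>a + b\<close>.\<close>

lemma X_minimal_polynomial:
  defines "XX \<equiv> \<lambda>y. blinfun_apply X (blinfun_apply X y)"
  shows "16 *\<^sub>R XX (XX y) + XX y \<in> span {a - b, q}"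
proof -
  define R where "R = (\<lambda>y. 16 *\<^sub>R XX (XX y) + XX y)"
  define W where "W = {y. R y \<in> span {a - b, q}}"
  have W: "subspace W"
    unfolding W_def
  proof (rule subspaceI)
    have add: "R (x + y) = R x + R y" for x y
      by (simp add: R_def XX_def blinfun.bilinear_simps scaleR_add_right)
    have scale: "R (t *\<^sub>R x) = t *\<^sub>R R x" for t x
      by (simp add: R_def XX_def blinfun.bilinear_simps scaleR_add_right mult.commute)
    show "0 \<in> {y. R y \<in> span {a - b, q}}" using scale[of 0 0] by (simp add: span_zero)
    show "x + y \<in> {y. R y \<in> span {a - b, q}}"
      if "x \<in> {y. R y \<in> span {a - b, q}}" "y \<in> {y. R y \<in> span {a - b, q}}" for x y
      using that by (simp add: add span_add)
    show "t *\<^sub>R x \<in> {y. R y \<in> span {a - b, q}}" if "x \<in> {y. R y \<in> span {a - b, q}}" for t x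
      using that by (simp add: scale span_scale)
  qed
  have pq: "a - b \<in> span {a - b, q}" "q \<in> span {a - b, q}" by (simp_all add: span_base)
  have Xpq: "blinfun_apply X y \<in> span {a - b, q}" if "y \<in> span {a - b, q}" for y
    using that
  proof (induction rule: span_induct_alt)
    case base
    then show ?case by (simp add: blinfun.bilinear_simps span_zero)
  next
    case (step t y z)
    then have "blinfun_apply X y \<in> span {a - b, q}"
      using X_basis(3,4) pq by (auto intro!: span_scale span_neg)
    then show ?case using step by (simp add: blinfun.bilinear_simps span_add span_scale)
  qed
  have in_W: "y \<in> W" if "blinfun_apply X y \<in> span {a - b, q}" for y
    unfolding W_def R_def XX_def using that by (auto intro!: span_add span_scale Xpq)
  have aW: "a \<in> W" and bW: "b \<in> W" and qW: "q \<in> W"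
    using X_basis pq by (auto intro!: in_W span_scale span_neg)
  have offW: "u \<in> W" if u: "a * u = (1/2) *\<^sub>R u" "b * u = (1/2) *\<^sub>R u" for u
  proof -
    \<comment> \<open>Remove the \<open>q\<close> component, where the 2 is
      \<open>q \<bullet> q\<close>; the remainder is killed by \<open>X\<close>.\<close>
    define u' where "u' = u - ((u \<bullet> q) / 2) *\<^sub>R q"
    have u': "a * u' = (1/2) *\<^sub>R u'" "b * u' = (1/2) *\<^sub>R u'" "q \<bullet> u' = 0"
      using u q norms by (simp_all add: u'_def jordan_simps scaleR_diff_right inner_diff_right inner_commute)
    have "blinfun_apply X u' = 0"
      using off_diagonal_orthogonal[OF u'] u' by (simp add: X_apply jordan_simps)
    then have "u' \<in> W" by (intro in_W) (simp add: span_zero)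
    moreover have "u = u' + ((u \<bullet> q) / 2) *\<^sub>R q" by (simp add: u'_def)
    ultimately show ?thesis using W qW by (metis subspace_add subspace_scale)
  qed
  \<comment> \<open>The 1-space of \<open>a + b\<close> splits into the lines of \<open>a\<close>
    and \<open>b\<close> and the off-diagonal space; decompose with respect to \<open>a\<close> and
    recover the action of \<open>b\<close>.\<close>
  have oneW: "v \<in> W" if v: "(a + b) * v = v" for v
  proof -
    obtain t h z where vd: "v = t + h + z" and t: "a * t = t" and h: "a * h = (1/2) *\<^sub>R h" and z: "a * z = 0"
      using peirce_decomposition[OF idempotents(1), of v] by blast
    have bt: "b * t = 0" using peirce_one_zero[OF idempotents(1) t ab] by (simp add: jordan_commute)
    have "a * v = t + (1/2) *\<^sub>R h" using vd t h z by (simp add: jordan_simps)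
    moreover have "b * v = b * h + b * z" using vd bt by (simp add: jordan_simps)
    ultimately have "t + (1/2) *\<^sub>R h + (b * h + b * z) = t + h + z"
      using v vd by (metis jordan_distrib_right)
    then have 1: "(1/2) *\<^sub>R h + b * h + b * z = h + z" by (simp add: algebra_simps)
    have abc: "a * (b * w) = b * (a * w)" for w
      using peirce_zero_commute[OF idempotents(1) ab] .
    \<comment> \<open>A further multiplication by \<open>a\<close> kills \<open>z\<close> and
      \<open>b * z\<close>, which isolates \<open>h\<close>.\<close>
    have "a * ((1/2) *\<^sub>R h + b * h + b * z) = a * (h + z)" using 1 by simp
    then have "(1/4) *\<^sub>R h + (1/2) *\<^sub>R (b * h) = (1/2) *\<^sub>R h"
      by (simp add: jordan_simps h z abc)
    then have "2 *\<^sub>R ((1/4) *\<^sub>R h + (1/2) *\<^sub>R (b * h)) = 2 *\<^sub>R ((1/2) *\<^sub>R h)" by (rule arg_cong)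
    then have 2: "(1/2) *\<^sub>R h + b * h = h" by (simp add: scaleR_add_right)
    moreover have "h = (1/2) *\<^sub>R h + (1/2) *\<^sub>R h" by (simp flip: scaleR_add_left)
    ultimately have bh: "b * h = (1/2) *\<^sub>R h" by (metis add_left_imp_eq)
    have bz: "b * z = z" using 1 2 by simp
    obtain s where "t = s *\<^sub>R a" using primitive_peirce_one[OF primitive(1) t] by blast
    moreover obtain s' where "z = s' *\<^sub>R b" using primitive_peirce_one[OF primitive(2) bz] by blast
    ultimately show ?thesis
      unfolding vd using W aW bW offW[OF h bh] by (auto intro!: subspace_add subspace_scale)
  qed
  obtain v h z where yd: "y = v + h + z" and v: "(a + b) * v = v"
    and h: "(a + b) * h = (1/2) *\<^sub>R h" and z: "(a + b) * z = 0"
    using peirce_decomposition[OF idempotents(3), of y] by blast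
  have "h \<in> W"
  proof -
    have "XX (XX h) = (1/256) *\<^sub>R h" "XX h = (-1/16) *\<^sub>R h"
      using X_X_half[OF h] by (simp_all add: XX_def blinfun.bilinear_simps)
    then have "R h = 0" by (simp add: R_def)
    then show ?thesis by (simp add: W_def span_zero)
  qed
  moreover have "z \<in> W"
  proof -
    have "a * z = 0"
      by (rule peirce_one_zero[OF idempotents(3) _ z]) (simp add: jordan_simps aa ba)
    moreover have "q * z = 0"
      by (rule peirce_one_zero[OF idempotents(3) _ z]) (use q in \<open>simp add: jordan_simps flip: scaleR_add_left\<close>)
    ultimately have "blinfun_apply X z = 0" by (simp add: X_apply)
    then show ?thesis by (intro in_W) (simp add: span_zero)
  qed
  ultimately have "y \<in> W" unfolding yd using W oneW[OF v] by (intro subspace_add)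
  then show ?thesis by (simp add: W_def R_def)
qed

text \<open>Real form of X(u + iv) = i\<theta>(u + iv). For these \<theta> the polynomial of
  \<open>X_minimal_polynomial\<close> acts on \<open>u\<close> by a nonzero scalar, which puts
  \<open>u\<close> into the rotation plane. There X^2 = -1/4, so \<theta> > 1/2 leaves zero
  only.\<close>

lemma X_eigenvector:
  assumes u: "blinfun_apply X u = - (\<theta> *\<^sub>R v)" and v: "blinfun_apply X v = \<theta> *\<^sub>R u" and \<theta>: "\<theta> \<ge> 1/2"
  obtains z where "(u, v) = cscale z (a - b, q)" "\<theta> > 1/2 \<Longrightarrow> (u, v) = 0"
proof -
  have XX: "blinfun_apply X (blinfun_apply X u) = - \<theta>\<^sup>2 *\<^sub>R u"
    by (simp add: u v blinfun.bilinear_simps power2_eq_square)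
  have XXX: "blinfun_apply X (blinfun_apply X (t *\<^sub>R u)) = (- \<theta>\<^sup>2 * t) *\<^sub>R u" for t
    by (simp only: blinfun.scaleR_right XX scaleR_scaleR mult.commute)
  have "(16 * (\<theta>\<^sup>2 * \<theta>\<^sup>2) - \<theta>\<^sup>2) *\<^sub>R u \<in> span {a - b, q}"
    using X_minimal_polynomial[of u] unfolding XX XXX by (simp add: scaleR_diff_left)
  moreover have "16 * (\<theta>\<^sup>2 * \<theta>\<^sup>2) - \<theta>\<^sup>2 = \<theta>\<^sup>2 * (16 * \<theta>\<^sup>2 - 1)" by (simp add: algebra_simps)
  ultimately have in_span: "(\<theta>\<^sup>2 * (16 * \<theta>\<^sup>2 - 1)) *\<^sub>R u \<in> span {a - b, q}" by simp
  have "\<theta>\<^sup>2 \<ge> (1/2)\<^sup>2" using \<theta> by (intro power_mono) auto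
  then have t: "\<theta>\<^sup>2 \<ge> 1/4" by (simp add: power2_eq_square)
  define k where "k = \<theta>\<^sup>2 * (16 * \<theta>\<^sup>2 - 1)"
  have "k \<noteq> 0" using t unfolding k_def by auto
  then have "u \<in> span {a - b, q}"
    using span_scale[OF in_span, of "inverse k"] by (simp flip: k_def)
  then obtain s r where "u - s *\<^sub>R (a - b) = r *\<^sub>R q"
    unfolding span_breakdown_eq span_singleton by blast
  then have us: "u = s *\<^sub>R (a - b) + r *\<^sub>R q" by (simp add: algebra_simps)
  have rotation: "blinfun_apply X (s *\<^sub>R (a - b) + r *\<^sub>R q) = (r / 2) *\<^sub>R (a - b) + (- s / 2) *\<^sub>R q" for s r
    by (simp only: blinfun.add_right blinfun.scaleR_right X_basis) simp
  have Xu: "blinfun_apply X u = (r / 2) *\<^sub>R (a - b) + (- s / 2) *\<^sub>R q"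
    unfolding us by (rule rotation)
  have "blinfun_apply X (blinfun_apply X u) = (- (1/4)) *\<^sub>R u"
    unfolding Xu rotation by (simp add: us scaleR_add_right)
  then have "(\<theta>\<^sup>2 - 1/4) *\<^sub>R u = 0" using XX by (simp add: scaleR_diff_left)
  then have big: "(u, v) = 0" if th: "\<theta> > 1/2"
  proof -
    have "\<theta>\<^sup>2 > (1/2)\<^sup>2" using th by (intro power_strict_mono) auto
    then have "u = 0" using \<open>(\<theta>\<^sup>2 - 1/4) *\<^sub>R u = 0\<close> by (auto simp: power2_eq_square)
    then show ?thesis using u th by (simp add: zero_prod_def)
  qed
  show ?thesis
  proof (cases "\<theta> > 1/2")
    case True
    show ?thesis by (rule that[of 0]) (simp_all add: big[OF True] cscale_def zero_prod_def)
  next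
    case False
    then have \<theta>: "\<theta> = 1/2" using \<theta> by simp
    have "v = (- 2) *\<^sub>R blinfun_apply X u" unfolding u \<theta> by simp
    also have "\<dots> = s *\<^sub>R q - r *\<^sub>R (a - b)" unfolding Xu by (simp add: scaleR_diff_right)
    \<comment> \<open>With p = a - b: (s - ir)(p + iq) = (sp + rq) + i(sq - rp).\<close>
    finally have "(u, v) = cscale (Complex s (- r)) (a - b, q)"
      by (simp add: us cscale_def)
    then show ?thesis using that \<theta> by blast
  qed
qed

definition "w = (a - b, q)"

lemma isotropic:
  "(a - b) * (a - b) = q * q" "(a - b) * q = 0" "(a - b) \<bullet> 1 = 0" "q \<bullet> 1 = 0"
  "(a - b) \<bullet> (a - b) = 2" "(a - b) \<bullet> q = 0"
proof -
  have ab0: "a \<bullet> b = 0" using inner_jordan[of a a b] by (simp add: aa ab)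
  have a1: "a \<bullet> 1 = 1" "b \<bullet> 1 = 1"
    using inner_jordan[of a a 1] inner_jordan[of b b 1] norms by (simp_all add: aa bb jordan_unit_right)
  have "a \<bullet> q = 1/2 * (a \<bullet> q)" "b \<bullet> q = 1/2 * (b \<bullet> q)"
    using inner_jordan[of a a q] inner_jordan[of b b q] unfolding aa bb q inner_scaleR_right by simp_all
  then have aq: "a \<bullet> q = 0" and "b \<bullet> q = 0" by linarith+
  then show "(a - b) \<bullet> q = 0" by (simp add: inner_diff_left)
  have "a \<bullet> q = q \<bullet> 1 / 2"
    using inner_jordan[of q a 1] q by (simp add: jordan_unit_right jordan_commute[of q a] inner_commute)
  then show "q \<bullet> 1 = 0" using aq by simp
  show "(a - b) * (a - b) = q * q" by (simp add: jordan_simps aa bb ab ba qq)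
  show "(a - b) * q = 0" by (simp add: jordan_simps q)
  show "(a - b) \<bullet> 1 = 0" by (simp add: inner_diff_left a1)
  show "(a - b) \<bullet> (a - b) = 2" using ab0 norms by (simp add: inner_diff_left inner_diff_right inner_commute)
qed

text \<open>The first pairing reads off the scalar in a multiple of \<open>w\<close>; the second
  makes the highest weight function nonzero at \<open>a\<close>.\<close>

lemma cbilinear_w: "cbilinear (cvec (a - b)) w = 2" "cbilinear (cvec a) w = 1"
proof -
  have "a \<bullet> b = 0" using inner_jordan[of a a b] by (simp add: aa ab)
  moreover have "a \<bullet> q = 1/2 * (a \<bullet> q)"
    using inner_jordan[of a a q] unfolding aa q inner_scaleR_right by simp
  ultimately show "cbilinear (cvec a) w = 1"
    using norms by (simp add: cbilinear_cvec w_def inner_diff_right complex_eq_iff)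
  show "cbilinear (cvec (a - b)) w = 2"
    by (simp add: cbilinear_cvec w_def isotropic complex_eq_iff)
qed

lemma cscale_w_eq_0: "cscale z w = 0 \<Longrightarrow> z = 0"
  using cbilinear_w(1) cbilinear_cscale_right[of "cvec (a - b)" z w]
  by (simp add: cbilinear_cvec complex_eq_iff)

text \<open>\<open>w\<close> has \<open>X\<close>-eigenvalue i/2 and \<open>Z\<close> shifts it by
  i\<eta>, so \<open>X_eigenvector\<close> applies to \<open>capply Z w\<close>.\<close>

lemma capply_eigenvector:
  assumes Z: "cbracket (cvec X) Z = cscale (\<i> * of_real \<eta>) Z" and \<eta>: "\<eta> \<ge> 0"
  obtains z where "capply Z w = cscale z w" "\<eta> > 0 \<Longrightarrow> capply Z w = 0"
proof -
  obtain u v where uv: "capply Z w = (u, v)" by (cases "capply Z w")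
  have "capply (cvec X) w = cscale (\<i> / 2) w"
    by (simp add: capply_def cvec_def w_def cscale_def X_basis flip: scaleR_minus_right)
  then have "capply (cvec X) (capply Z w) = cscale (\<i> * of_real (1/2 + \<eta>)) (capply Z w)"
    using capply_cbracket[of "cvec X" Z w] unfolding Z capply_cscale
    by (simp add: capply_cscale_right cscale_add_left algebra_simps)
  then have "blinfun_apply X u = - ((1/2 + \<eta>) *\<^sub>R v)" "blinfun_apply X v = (1/2 + \<eta>) *\<^sub>R u"
    unfolding uv by (simp_all add: capply_def cvec_def cscale_def)
  from X_eigenvector[OF this] \<eta> obtain z where "(u, v) = cscale z (a - b, q)" "1/2 + \<eta> > 1/2 \<Longrightarrow> (u, v) = 0"
    by auto
  with uv w_def have "capply Z w = cscale z w" "\<eta> > 0 \<Longrightarrow> capply Z w = 0" by auto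
  then show ?thesis by (rule that)
qed

end

section \<open>Roots\<close>

text \<open>\<open>ad H\<close> is skew for the Hilbert-Schmidt inner product.\<close>

lemma derivation_eigenvalue_imaginary:
  assumes H: "H \<in> (derivations :: ('a::euclidean_jordan_algebra \<Rightarrow>\<^sub>L 'a) set)"
    and Z: "cbracket (cvec H) Z = cscale z Z" "Z \<noteq> 0"
  shows "Re z = 0"
proof -
  define hs where "hs = (\<lambda>A B :: 'a \<Rightarrow>\<^sub>L 'a. \<Sum>i\<in>Basis. blinfun_apply A i \<bullet> blinfun_apply B i)"
  have comm: "hs A B = hs B A" for A B by (simp add: hs_def inner_commute)
  have pos: "hs A A \<ge> 0" "hs A A = 0 \<Longrightarrow> A = 0" for A
  proof -
    show "hs A A \<ge> 0" by (simp add: hs_def sum_nonneg)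
    assume "hs A A = 0"
    then have "\<forall>i\<in>Basis. blinfun_apply A i = 0" by (simp add: hs_def sum_nonneg_eq_0_iff)
    then show "A = 0" by (intro blinfun_euclidean_eqI) simp
  qed
  have skew: "hs (bracket H A) A = 0" for A
  proof -
    have 1: "blinfun_apply H y \<bullet> y = 0" for y using derivation_skew[OF H, of y y] by (simp add: inner_commute)
    have "(\<Sum>i\<in>Basis. blinfun_apply A (blinfun_apply H i) \<bullet> blinfun_apply A i)
        = (\<Sum>i\<in>Basis. \<Sum>j\<in>Basis. (blinfun_apply H i \<bullet> j) * (blinfun_apply A j \<bullet> blinfun_apply A i))"
      (is "?s = ?t")
    proof (rule sum.cong)
      fix i :: 'a
      have "blinfun_apply A (blinfun_apply H i) = blinfun_apply A (\<Sum>j\<in>Basis. (blinfun_apply H i \<bullet> j) *\<^sub>R j)"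
        by (simp add: euclidean_representation)
      then show "blinfun_apply A (blinfun_apply H i) \<bullet> blinfun_apply A i =
          (\<Sum>j\<in>Basis. (blinfun_apply H i \<bullet> j) * (blinfun_apply A j \<bullet> blinfun_apply A i))"
        by (simp add: blinfun.sum_right blinfun.scaleR_right inner_sum_left)
    qed simp
    \<comment> \<open>Exchanging \<open>i\<close> and \<open>j\<close> reverses the sign: the matrix
      of \<open>H\<close> is antisymmetric, the other factor symmetric.\<close>
    moreover have "?t = (\<Sum>i\<in>Basis. \<Sum>j\<in>Basis. - ((blinfun_apply H i \<bullet> j) * (blinfun_apply A j \<bullet> blinfun_apply A i)))"
    proof (subst sum.swap, intro sum.cong refl)
      fix i j :: 'a
      have "blinfun_apply H j \<bullet> i = - (blinfun_apply H i \<bullet> j)"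
        by (metis derivation_skew[OF H] inner_commute)
      then show "(blinfun_apply H j \<bullet> i) * (blinfun_apply A i \<bullet> blinfun_apply A j)
          = - ((blinfun_apply H i \<bullet> j) * (blinfun_apply A j \<bullet> blinfun_apply A i))"
        by (simp only: inner_commute[of "blinfun_apply A i" "blinfun_apply A j"] mult_minus_left)
    qed
    then have "?t = - ?t" unfolding sum_negf .
    ultimately have "?s = 0" by linarith
    then show ?thesis by (simp add: hs_def bracket_apply inner_diff_left sum_subtractf 1)
  qed
  obtain A B where AB: "Z = (A, B)" by (cases Z)
  have br: "bracket H A = Re z *\<^sub>R A - Im z *\<^sub>R B" "bracket H B = Re z *\<^sub>R B + Im z *\<^sub>R A"
    using Z(1) by (simp_all add: AB cbracket_def cvec_def cscale_def)
  have "Re z * hs A A = Im z * hs B A" "Re z * hs B B = - (Im z * hs A B)"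
    using skew[of A] skew[of B] unfolding br
    by (simp_all add: hs_def blinfun.bilinear_simps inner_diff_left inner_add_left sum_subtractf sum.distrib
        flip: sum_distrib_left)
  \<comment> \<open>The \<open>Im z\<close> terms cancel in the sum, since \<open>hs\<close> is
    symmetric.\<close>
  then have "Re z * (hs A A + hs B B) = 0" using comm[of A B] by (simp add: algebra_simps)
  moreover have "hs A A + hs B B \<noteq> 0"
    using Z(2) pos[of A] pos[of B] unfolding AB by (auto simp: zero_prod_def add_nonneg_eq_0_iff)
  ultimately show ?thesis by simp
qed

lemma cvec_in_complexify: "subspace T \<Longrightarrow> H \<in> T \<Longrightarrow> cvec H \<in> complexify T"
  by (simp add: complexify_def cvec_def subspace_0)

lemma root_imaginary:
  assumes T: "T \<subseteq> (derivations :: ('a::euclidean_jordan_algebra \<Rightarrow>\<^sub>L 'a) set)" "subspace T"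
    and \<alpha>: "\<alpha> \<in> roots T" and H: "H \<in> T"
  obtains y where "\<alpha> (cvec H) = \<i> * of_real y"
proof -
  obtain Z where Z: "Z \<in> root_space T \<alpha>" "Z \<noteq> 0" using \<alpha> unfolding roots_def by blast
  then have "cbracket (cvec H) Z = cscale (\<alpha> (cvec H)) Z"
    using cvec_in_complexify[OF T(2) H] by (simp add: root_space_def)
  then have "Re (\<alpha> (cvec H)) = 0" using derivation_eigenvalue_imaginary T(1) H Z(2) by blast
  then show ?thesis using that[of "Im (\<alpha> (cvec H))"] by (simp add: complex_eq_iff)
qed

text \<open>Complex conjugation maps the root space of \<open>\<alpha>\<close> to that of \<open>- \<alpha>\<close>.\<close>

lemma uminus_root:
  assumes T: "T \<subseteq> (derivations :: ('a::euclidean_jordan_algebra \<Rightarrow>\<^sub>L 'a) set)" "subspace T"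
    and \<alpha>: "\<alpha> \<in> roots T"
  shows "(\<lambda>H. - \<alpha> H) \<in> roots T"
proof -
  have lin: "clinear_on (complexify T) \<alpha>" and off: "\<And>H. H \<notin> complexify T \<Longrightarrow> \<alpha> H = 0"
    and ne: "\<exists>H\<in>complexify T. \<alpha> H \<noteq> 0" using \<alpha> by (auto simp: roots_def)
  obtain A B where Z: "(A, B) \<in> root_space T \<alpha>" "(A, B) \<noteq> 0" using \<alpha> unfolding roots_def by auto
  have "(A, - B) \<in> root_space T (\<lambda>H. - \<alpha> H)"
    unfolding root_space_def
  proof (intro CollectI conjI ballI)
    have "A \<in> derivations" "B \<in> derivations" using Z(1) by (auto simp: root_space_def complexify_def)
    then show "(A, - B) \<in> complexify derivations"
      by (simp add: complexify_def derivations_def blinfun.bilinear_simps jordan_minus)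
    fix H assume H: "H \<in> complexify T"
    obtain H1 H2 where H12: "H = (H1, H2)" "H1 \<in> T" "H2 \<in> T" using H by (auto simp: complexify_def)
    \<comment> \<open>On the real torus a root is imaginary, so its negative is its complex
      conjugate there.\<close>
    obtain y1 where y1: "\<alpha> (cvec H1) = \<i> * of_real y1" using root_imaginary[OF T \<alpha> H12(2)] .
    obtain y2 where y2: "\<alpha> (cvec H2) = \<i> * of_real y2" using root_imaginary[OF T \<alpha> H12(3)] .
    have mem: "cvec H1 \<in> complexify T" "cvec H2 \<in> complexify T"
      using H12 T(2) by (auto intro: cvec_in_complexify)
    then have "cscale \<i> (cvec H2) \<in> complexify T"
      using T(2) H12 by (simp add: complexify_def cscale_def cvec_def subspace_0)
    then have "\<alpha> (cvec H1 + cscale \<i> (cvec H2)) = \<alpha> (cvec H1) + \<i> * \<alpha> (cvec H2)"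
      using lin mem unfolding clinear_on_def by metis
    moreover have "cvec H1 + cscale \<i> (cvec H2) = H" by (simp add: H12 cvec_def cscale_def)
    ultimately have \<alpha>H: "\<alpha> H = Complex (- y2) y1" by (simp add: y1 y2 complex_eq_iff)
    have "cbracket (cvec H1) (A, B) = cscale (\<i> * of_real y1) (A, B)"
      "cbracket (cvec H2) (A, B) = cscale (\<i> * of_real y2) (A, B)"
      using Z(1) mem y1 y2 by (simp_all add: root_space_def)
    then have "bracket H1 A = - (y1 *\<^sub>R B)" "bracket H1 B = y1 *\<^sub>R A"
      "bracket H2 A = - (y2 *\<^sub>R B)" "bracket H2 B = y2 *\<^sub>R A"
      by (simp_all add: cbracket_def cvec_def cscale_def)
    then show "cbracket H (A, - B) = cscale (- \<alpha> H) (A, - B)"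
      unfolding \<alpha>H by (simp add: H12 cbracket_def cscale_def)
  qed
  moreover have "(A, - B) \<noteq> 0" using Z(2) by (simp add: zero_prod_def)
  moreover have "clinear_on (complexify T) (\<lambda>H. - \<alpha> H)" using lin by (simp add: clinear_on_def)
  ultimately show ?thesis using off ne unfolding roots_def by fastforce
qed

section \<open>Weight of the power of \<open>w\<close> under the torus, and its annihilation by
  positive root vectors\<close>

theorem proposition1p19:
  fixes tr :: "'a::euclidean_jordan_algebra \<Rightarrow> real"
    and c :: "nat \<Rightarrow> 'a" and x0 :: 'a and r d m :: nat
    and X0 :: "'a \<Rightarrow>\<^sub>L 'a" and T :: "('a \<Rightarrow>\<^sub>L 'a) set"
    and \<gamma> :: "('a \<Rightarrow>\<^sub>L 'a) \<times> ('a \<Rightarrow>\<^sub>L 'a) \<Rightarrow> complex"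
    and P :: "(('a \<Rightarrow>\<^sub>L 'a) \<times> ('a \<Rightarrow>\<^sub>L 'a) \<Rightarrow> complex) set"
  assumes simple: "simple_jordan_algebra TYPE('a)"
    and trace: "is_jordan_trace tr"
    and trace_form: "\<And>x y :: 'a. x \<bullet> y = tr (x * y)"
    and rank: "jordan_rank TYPE('a) = r" "r > 1"
    and frame: "jordan_frame r c"
    and peirce_dim: "\<And>i j. 1 \<le> i \<Longrightarrow> i < j \<Longrightarrow> j \<le> r \<Longrightarrow> dim (peirce_space c i j) = d"
    and nondegenerate: "r > 2 \<or> d > 1"
    and x0: "x0 \<in> peirce_space c 1 2" "(norm x0)\<^sup>2 = 2"
    and X0: "X0 = bracket (mult_op (c 1)) (mult_op x0)"
    and torus: "maximal_torus T" "complexify (span {X0}) \<subseteq> complexify T"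
    and gamma: "clinear_on (complexify T) \<gamma>" "\<gamma> (cvec X0) = (1/4) * \<i>"
      "\<And>H. H \<in> complexify T \<inter> complexify (stabilizer_derivations (c 1)) \<Longrightarrow> \<gamma> H = 0"
    and ordering: "positive_system (roots T) P"
      "\<And>\<alpha> s. \<alpha> \<in> roots T \<Longrightarrow> s > (0::real) \<Longrightarrow>
         (\<forall>H\<in>complexify (span {X0}). \<alpha> H = of_real s * \<gamma> H) \<Longrightarrow> \<alpha> \<in> P"
  shows "highest_weight_vector (Xi_sphere (c 1)) (harmonics_sphere (real d / 2) (c 1) m) T P
           (phi (c 1) (c 2) x0 m)"
proof -
  note One_nat_def [simp del]
  have in12: "1 \<in> {1..r}" "2 \<in> {1..r}" using rank(2) by auto
  interpret peirce_triple "c 1" "c 2" x0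
  proof
    show "primitive_idempotent (c 1)" "primitive_idempotent (c 2)" "c 1 * c 2 = 0"
      using jordan_frameD[OF frame] in12 by auto
    show "c 1 \<bullet> c 1 = 1" "c 2 \<bullet> c 2 = 1"
      using jordan_frameD(2)[OF frame] frame_trace[OF trace rank(1) frame] in12 by (auto simp: trace_form)
    show "x0 \<bullet> x0 = 2" using x0(2) by (simp add: power2_norm_eq_inner)
    show "c 1 * x0 = (1/2) *\<^sub>R x0" "c 2 * x0 = (1/2) *\<^sub>R x0"
      using x0(1) by (simp_all add: peirce_space_def)
  qed
  let ?S = "Xi_sphere (c 1)"
  define f where "f = restrict (\<lambda>x. cbilinear (cvec x) w ^ m) ?S"
  have f: "phi (c 1) (c 2) x0 m = f"
    unfolding f_def phi_def w_def by (simp add: cvec_def cscale_def)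
  have X: "X0 = X" using X0 X_def by simp
  have T: "subspace T" "T \<subseteq> derivations" and abelian: "\<And>A B. A \<in> T \<Longrightarrow> B \<in> T \<Longrightarrow> bracket A B = 0"
    using torus(1) by (auto simp: maximal_torus_def abelian_in_derivations_def)
  have "cvec X \<in> complexify (span {X0})"
    by (rule cvec_in_complexify) (simp_all add: X span_base)
  then have XTC: "cvec X \<in> complexify T" using torus(2) by blast
  then have XT: "X \<in> T" by (simp add: complexify_def cvec_def)
  have TD: "complexify T \<subseteq> complexify derivations" using T(2) by (auto simp: complexify_def)

  \<comment> \<open>The torus is abelian and contains \<open>X\<close>, which is the case \<eta> = 0
    of \<open>capply_eigenvector\<close>.\<close>
  have eigen: "\<exists>z. capply H w = cscale z w" if H: "H \<in> complexify T" for H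
  proof -
    have "cbracket (cvec X) H = cscale (\<i> * of_real 0) H"
      using H abelian XT by (auto simp: complexify_def cbracket_def cvec_def cscale_def zero_prod_def)
    from capply_eigenvector[OF this] show ?thesis by auto
  qed
  \<comment> \<open>Reading the eigenvalue off by pairing with \<open>c 1 - c 2\<close> makes its
    linearity in \<open>H\<close> immediate.\<close>
  define \<nu> where "\<nu> = (\<lambda>H. cbilinear (cvec (c 1 - c 2)) (capply H w) / 2)"
  have \<nu>: "capply H w = cscale (\<nu> H) w" if "H \<in> complexify T" for H
  proof -
    obtain z where z: "capply H w = cscale z w" using eigen \<open>H \<in> complexify T\<close> by blast
    have "\<nu> H = z * (cbilinear (cvec (c 1 - c 2)) w / 2)" unfolding \<nu>_def z cbilinear_cscale_right by simp
    also have "cbilinear (cvec (c 1 - c 2)) w = 2"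
      by (rule cbilinear_w)
    finally show ?thesis using z by simp
  qed
  have \<nu>_linear: "clinear_on (complexify T) (\<lambda>H. of_nat m * \<nu> H)"
    by (simp add: clinear_on_def \<nu>_def capply_add capply_cscale cbilinear_add_right cbilinear_cscale_right
        add_divide_distrib algebra_simps)
  have action: "lie_action_complex ?S Z f x = of_nat m * z * f x"
    if Z: "Z \<in> complexify derivations" and z: "capply Z w = cscale z w" and x: "x \<in> ?S" for Z z x
  proof -
    have "lie_action_complex ?S Z f x =
        of_nat m * (z * cbilinear (cvec x) w) * cbilinear (cvec x) w ^ (m - 1)"
      unfolding f_def lie_action_complex_power[OF Z x] z cbilinear_cscale_right ..
    \<comment> \<open>At \<open>m = 0\<close> both sides vanish, so the truncated
      \<open>m - 1\<close> does no harm.\<close>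
    also have "\<dots> = of_nat m * z * cbilinear (cvec x) w ^ m"
      by (cases m) simp_all
    finally show ?thesis using x by (simp add: f_def)
  qed

  have kills: "capply Z w = 0" if \<alpha>: "\<alpha> \<in> P" and Z: "Z \<in> root_space T \<alpha>" for \<alpha> Z
  proof -
    have root: "\<alpha> \<in> roots T" using \<alpha> ordering(1) unfolding positive_system_def by blast
    obtain y where y: "\<alpha> (cvec X) = \<i> * of_real y" using root_imaginary[OF T(2,1) root XT] .
    have "y \<ge> 0"
    proof (rule ccontr)
      assume "\<not> y \<ge> 0"
      \<comment> \<open>As \<gamma> is i/4 at \<open>X\<close>, the ratio on the line of
        \<open>X\<close> is \<open>- 4 * y\<close>. For \<open>y < 0\<close> the ordering would make
        the negative of the positive root \<alpha> positive as well.\<close>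
      have "- \<alpha> H = of_real (- 4 * y) * \<gamma> H" if H0: "H \<in> complexify (span {X0})" for H
      proof -
        obtain s t where "H = (s *\<^sub>R X, t *\<^sub>R X)"
          using H0 unfolding X complexify_def span_singleton by blast
        then have H: "H = cscale (Complex s t) (cvec X)" by (simp add: cscale_def cvec_def)
        have "clinear_on (complexify T) \<alpha>" using root by (simp add: roots_def)
        then have "\<alpha> H = Complex s t * \<alpha> (cvec X)" "\<gamma> H = Complex s t * \<gamma> (cvec X)"
          using gamma(1) XTC unfolding H by (auto simp: clinear_on_def)
        then show ?thesis by (simp only: y gamma(2)[unfolded X]) simp
      qed
      moreover have "- 4 * y > 0" using \<open>\<not> y \<ge> 0\<close> by simp
      ultimately have "(\<lambda>H. - \<alpha> H) \<in> P"
        by (intro ordering(2)[OF uminus_root[OF T(2,1) root], of "- 4 * y"] ballI)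
      moreover have "\<alpha> \<in> P \<longleftrightarrow> (\<lambda>H. - \<alpha> H) \<notin> P"
        using ordering(1) root unfolding positive_system_def by blast
      ultimately show False using \<alpha> by blast
    qed
    have "cbracket (cvec X) Z = cscale (\<i> * of_real y) Z"
      using Z XTC y by (simp add: root_space_def)
    from capply_eigenvector[OF this \<open>y \<ge> 0\<close>] obtain z where z: "capply Z w = cscale z w" by metis
    \<comment> \<open>Both \<open>H\<close> and \<open>Z\<close> scale \<open>w\<close>, so their
      bracket kills it; but that bracket is \<alpha>(H) times \<open>Z\<close>. Since a root is
      nonzero at some \<open>H\<close>, the scalar \<open>z\<close> is zero.\<close>
    obtain H where H: "H \<in> complexify T" "\<alpha> H \<noteq> 0" using root by (auto simp: roots_def)
    have "cscale (\<alpha> H * z) w = capply (cbracket H Z) w"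
      using Z H(1) by (simp add: root_space_def capply_cscale z cscale_cscale)
    also have "\<dots> = 0"
      by (simp add: capply_cbracket z \<nu>[OF H(1)] capply_cscale_right cscale_cscale mult.commute)
    finally have "\<alpha> H * z = 0" by (rule cscale_w_eq_0)
    then show ?thesis using z H(2) by (simp add: cscale_def zero_prod_def)
  qed

  \<comment> \<open>The identity lies in the structure group, so the base point \<open>c 1\<close>
    lies on the sphere and can witness that the function is nonzero.\<close>
  have "blinfun_apply (id_blinfun :: 'a \<Rightarrow>\<^sub>L 'a) = id" by (simp add: fun_eq_iff)
  moreover have "adjoint (id :: 'a \<Rightarrow> 'a) = id" by (rule adjoint_unique) simp
  ultimately have "id_blinfun \<in> (structure_group :: ('a \<Rightarrow>\<^sub>L 'a) set)"
    by (simp add: structure_group_def)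
  then have "id_blinfun \<in> (structure_group0 :: ('a \<Rightarrow>\<^sub>L 'a) set)"
    by (simp add: structure_group0_def connected_component_refl)
  then have "c 1 \<in> Xi_orbit (c 1)" unfolding Xi_orbit_def by (rule rev_image_eqI) simp
  then have c1: "c 1 \<in> ?S" using norms(1) by (simp add: Xi_sphere_def norm_eq_1)
  show ?thesis
    unfolding f highest_weight_vector_def
  proof (intro conjI ballI exI[of _ "\<lambda>H. of_nat m * \<nu> H"] bexI[OF _ c1] \<nu>_linear)
    show "f \<in> harmonics_sphere (real d / 2) (c 1) m"
      unfolding f_def w_def by (rule power_in_harmonics_sphere[OF isotropic(1-4)])
    show "f (c 1) \<noteq> 0" using c1 cbilinear_w(2) by (simp add: f_def)
    fix x assume x: "x \<in> ?S"
    show "lie_action_complex ?S H f x = of_nat m * \<nu> H * f x" if H: "H \<in> complexify T" for H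
      using TD H by (intro action \<nu> x) auto
    fix \<alpha> Z assume Z: "\<alpha> \<in> P" "Z \<in> root_space T \<alpha>"
    have "Z \<in> complexify derivations" using Z(2) by (simp add: root_space_def)
    moreover have "capply Z w = cscale 0 w" using kills[OF Z] by (simp add: cscale_def zero_prod_def)
    ultimately show "lie_action_complex ?S Z f x = 0" using action[of Z 0 x] x by simp
  qed
qed

end
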